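(* Let $p$ be a prime. Then the distinct lower covers of $\mathbb C_p$ (in $\mathfrak P_{\mathrm{Digraphs}}$) are $\mathbb T_3\times\mathbb C_p,\ \mathbb C_{p\cdot q_1},\ \mathbb C_{p\cdot q_2},\dots$, where $q_1,q_2,\dots$ are the primes not equal to $p$.
   Context: Structures have nonempty domains; a digraph is a structure with one binary relation. A primitive positive (pp) formula is a first-order formula built from atomic formulas $R(x_1,\dots,x_n)$, $x\approx y$, and the always-false formula $\bot$ using only conjunction and existential quantification. A structure is a pp-power of $\mathbb A$ if it is isomorphic to a structure with domain $A^n$ for some $n\geq 1$ whose relations are pp-definable in $\mathbb A$ (a $k$-ary relation on $A^n$ being regarded as a $kn$-ary relation on $A$). $\mathbb A\leq\mathbb B$ means that $\mathbb B$ is homomorphically equivalent to a pp-power of $\mathbb A$; this is a quasi-order, and $[\mathbb A]$ denotes the class of $\mathbb A$ under the induced equivalence. $\mathfrak P_{\mathrm{Digraphs}}$ is the poset of all $[\mathbb G]$, $\mathbb G$ a finite digraph, ordered by $[\mathbb A]\leq[\mathbb B]$ iff $\mathbb A\leq\mathbb B$. Digraphs are identified with the elements of $\mathfrak P_{\mathrm{Digraphs}}$ they represent. $\mathbb C_n$ is the directed cycle with $n$ vertices, $\mathbb T_3=(\{0,1,2\},\{(0,1),(0,2),(1,2)\})$, and $\times$ is the direct (categorical) product of digraphs: $((u,v),(u',v'))$ is an edge iff $(u,u')$ and $(v,v')$ are edges. *)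

theory Defs
  imports
    "HOL-Computational_Algebra.Primes"
    "HOL-Library.NList"
    "HOL-Algebra.Order"
    "Graph_Theory.Pair_Digraph"
    "Graph_Theory.Digraph_Isomorphism"
begin

text \<open>
  A digraph is a structure with a single binary relation: a nonempty vertex set and a set of
  ordered pairs of vertices. Loops are allowed.
\<close>

definition structure_digraph :: "'a pair_pre_digraph \<Rightarrow> bool" where
  "structure_digraph G \<longleftrightarrow> pair_wf_digraph G \<and> pverts G \<noteq> {}"

definition finite_digraph :: "'a pair_pre_digraph \<Rightarrow> bool" where
  "finite_digraph G \<longleftrightarrow> structure_digraph G \<and> pair_fin_digraph G"

definition digraph_hom :: "'a pair_pre_digraph \<Rightarrow> 'b pair_pre_digraph \<Rightarrow> ('a \<Rightarrow> 'b) \<Rightarrow> bool" where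
  "digraph_hom G H f \<longleftrightarrow>
     f ` pverts G \<subseteq> pverts H \<and> (\<forall>u v. (u, v) \<in> parcs G \<longrightarrow> (f u, f v) \<in> parcs H)"

definition hom_equivalent :: "'a pair_pre_digraph \<Rightarrow> 'b pair_pre_digraph \<Rightarrow> bool" where
  "hom_equivalent G H \<longleftrightarrow> (\<exists>f. digraph_hom G H f) \<and> (\<exists>g. digraph_hom H G g)"

text \<open>Primitive positive formulas in the signature of digraphs; variables are natural numbers.\<close>

datatype pp_formula =
    Bot
  | Rel nat nat
  | Equ nat nat
  | And pp_formula pp_formula
  | Exi nat pp_formula

primrec free_vars :: "pp_formula \<Rightarrow> nat set" where
  "free_vars Bot = {}"
| "free_vars (Rel x y) = {x, y}"
| "free_vars (Equ x y) = {x, y}"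
| "free_vars (And \<phi> \<psi>) = free_vars \<phi> \<union> free_vars \<psi>"
| "free_vars (Exi x \<phi>) = free_vars \<phi> - {x}"

primrec satisfies :: "'a pair_pre_digraph \<Rightarrow> (nat \<Rightarrow> 'a) \<Rightarrow> pp_formula \<Rightarrow> bool" where
  "satisfies A v Bot \<longleftrightarrow> False"
| "satisfies A v (Rel x y) \<longleftrightarrow> (v x, v y) \<in> parcs A"
| "satisfies A v (Equ x y) \<longleftrightarrow> v x = v y"
| "satisfies A v (And \<phi> \<psi>) \<longleftrightarrow> satisfies A v \<phi> \<and> satisfies A v \<psi>"
| "satisfies A v (Exi x \<phi>) \<longleftrightarrow> (\<exists>a\<in>pverts A. satisfies A (v(x := a)) \<phi>)"

text \<open>
  A \<open>k\<close>-ary relation is a set of lists of length \<open>k\<close>. The defining formula has its free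
  variables among \<open>0, \<dots>, k - 1\<close>, so the values of \<open>nth xs\<close> beyond the length
  of \<open>xs\<close> are irrelevant.
\<close>

definition pp_definable :: "'a pair_pre_digraph \<Rightarrow> nat \<Rightarrow> 'a list set \<Rightarrow> bool" where
  "pp_definable A k R \<longleftrightarrow>
     (\<exists>\<phi>. free_vars \<phi> \<subseteq> {..<k} \<and> R = {xs \<in> nlists k (pverts A). satisfies A (nth xs) \<phi>})"

text \<open>
  The digraph \<open>Q\<close> has vertex set \<open>A\<^sup>n\<close>, and its arc relation is regarded as
  a \<open>2n\<close>-ary relation on \<open>A\<close> by concatenation.
\<close>

definition pp_power :: "'a pair_pre_digraph \<Rightarrow> 'b pair_pre_digraph \<Rightarrow> bool" where
  "pp_power A P \<longleftrightarrow>
     (\<exists>n\<ge>1. \<exists>Q :: 'a list pair_pre_digraph.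
        structure_digraph Q \<and>
        pverts Q = nlists n (pverts A) \<and>
        pp_definable A (2 * n) {xs @ ys | xs ys. (xs, ys) \<in> parcs Q} \<and>
        digraph_iso (with_proj Q) (with_proj P))"

text \<open>
  The type of the bound variable \<open>P\<close> is no restriction: every pp-power of \<open>A\<close> has an
  isomorphic copy whose vertices are lists over \<open>A\<close>.
\<close>

definition pp_constructs :: "'a pair_pre_digraph \<Rightarrow> 'b pair_pre_digraph \<Rightarrow> bool"
    (infix \<open>\<le>\<^sub>p\<^sub>p\<close> 50) where
  "A \<le>\<^sub>p\<^sub>p B \<longleftrightarrow> (\<exists>P :: 'a list pair_pre_digraph. pp_power A P \<and> hom_equivalent B P)"

text \<open>
  Every finite digraph has an isomorphic copy with vertices in \<open>nat\<close>, so the class of a finite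
  digraph (over any type) is represented by its members over \<open>nat\<close>.
\<close>

definition pp_class :: "'a pair_pre_digraph \<Rightarrow> nat pair_pre_digraph set" where
  "pp_class A = {B. finite_digraph B \<and> A \<le>\<^sub>p\<^sub>p B \<and> B \<le>\<^sub>p\<^sub>p A}"

definition P_Digraphs :: "nat pair_pre_digraph set gorder" where
  "P_Digraphs =
     \<lparr> carrier = {pp_class G | G :: nat pair_pre_digraph. finite_digraph G},
       eq = (=),
       le = (\<lambda>X Y. \<exists>A\<in>X. \<exists>B\<in>Y. A \<le>\<^sub>p\<^sub>p B) \<rparr>"

definition lower_cover :: "('a, 'm) gorder_scheme \<Rightarrow> 'a \<Rightarrow> 'a \<Rightarrow> bool" where
  "lower_cover L x y \<longleftrightarrow>
     x \<in> carrier L \<and> y \<in> carrier L \<and> x \<sqsubset>\<^bsub>L\<^esub> y \<and>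
     \<not> (\<exists>z\<in>carrier L. x \<sqsubset>\<^bsub>L\<^esub> z \<and> z \<sqsubset>\<^bsub>L\<^esub> y)"

definition directed_cycle :: "nat \<Rightarrow> nat pair_pre_digraph" where
  "directed_cycle n = \<lparr> pverts = {..<n}, parcs = {(i, (i + 1) mod n) | i. i < n} \<rparr>"

definition T3 :: "nat pair_pre_digraph" where
  "T3 = \<lparr> pverts = {0, 1, 2}, parcs = {(0, 1), (0, 2), (1, 2)} \<rparr>"

definition direct_product ::
    "'a pair_pre_digraph \<Rightarrow> 'b pair_pre_digraph \<Rightarrow> ('a \<times> 'b) pair_pre_digraph"
    (infixr \<open>\<times>\<^sub>d\<close> 80) where
  "G \<times>\<^sub>d H =
     \<lparr> pverts = pverts G \<times> pverts H,
       parcs = {((u, v), (u', v')) | u v u' v'. (u, u') \<in> parcs G \<and> (v, v') \<in> parcs H} \<rparr>"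

end

theory Submission
  imports Defs "HOL-Number_Theory.Cong"
begin

text \<open>
  For finite digraphs, \<open>A \<le>\<^sub>p\<^sub>p B\<close> holds iff there is a minion homomorphism from the polymorphisms
  of \<open>A\<close> to those of \<open>B\<close>, iff the digraph freely generated by \<open>B\<close> in the polymorphism minion of
  \<open>A\<close> maps homomorphically to \<open>B\<close>. For \<open>B = T3\<close> the free digraph maps to \<open>B\<close> unless it has a walk
  of length 3, and the middle arc of such a walk is a quasi Maltsev polymorphism of \<open>A\<close>. For
  \<open>B\<close> a cycle of length \<open>n\<close> the free digraph is a union of cycles, and it maps to \<open>B\<close> unless
  \<open>A\<close> has an \<open>r\<close>-ary cyclic polymorphism for some prime \<open>r dvd n\<close>.

  Now let \<open>Z\<close> lie strictly below the cycle of length \<open>p\<close>, but neither below \<open>T3\<close> times that cycle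
  nor below any cycle of length \<open>p * q\<close>. Then \<open>Z\<close> has a quasi Maltsev polymorphism and cyclic
  polymorphisms of every prime arity except \<open>p\<close>. The former makes a retract of \<open>Z\<close> totally
  rectangular, so that closed walks control its homomorphisms to paths and cycles. If \<open>Z\<close> is acyclic,
  it is levelled by a path and inherits a symmetric polymorphism, which is impossible. Otherwise the
  cyclic polymorphisms shorten every closed walk to one whose length is a power of \<open>p\<close>, so \<open>Z\<close> is
  homomorphically equivalent to a cycle of length \<open>p ^ k\<close>, which is pp-constructible from the cycle of
  length \<open>p\<close>; this contradicts strictness.
\<close>

section \<open>Polymorphisms and minion homomorphisms\<close>

text \<open>As conditional rewrite rules these loop together with the definition of \<open>nlists\<close>.\<close>
declare nlistsE_length [simp del] nlistsE_set [simp del]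

abbreviation arc :: "'a pair_pre_digraph \<Rightarrow> 'a \<Rightarrow> 'a \<Rightarrow> bool" where
  "arc A x y \<equiv> (x, y) \<in> parcs A"

text \<open>Arguments come as lists, so the arity is a number and minors arise by reindexing. The
  closure clause also covers arguments that lie on no arc.\<close>

definition pol :: "'a pair_pre_digraph \<Rightarrow> nat \<Rightarrow> ('a list \<Rightarrow> 'a) \<Rightarrow> bool" where
  "pol A k f \<longleftrightarrow> (\<forall>xs\<in>nlists k (pverts A). f xs \<in> pverts A) \<and>
     (\<forall>xs ys. length xs = k \<longrightarrow> list_all2 (arc A) xs ys \<longrightarrow> arc A (f xs) (f ys))"

text \<open>The minor of a \<open>k\<close>-ary \<open>f\<close> along a map \<sigma> from
  \<open>k\<close> positions to \<open>m\<close> variables sends \<open>xs\<close> to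
  \<open>f (reindex k \<sigma> xs)\<close>.\<close>

definition reindex :: "nat \<Rightarrow> (nat \<Rightarrow> nat) \<Rightarrow> 'a list \<Rightarrow> 'a list" where
  "reindex k \<sigma> xs = map (\<lambda>i. xs ! \<sigma> i) [0..<k]"

text \<open>
  Operations of arity \<open>k\<close> have junk values off lists of length \<open>k\<close>, hence minors are
  related by pointwise equations instead of being operations themselves. Nullary operations are
  excluded because the formula \<open>Bot\<close> is not preserved by them.
\<close>

definition minion_hom ::
  "'a pair_pre_digraph \<Rightarrow> 'b pair_pre_digraph \<Rightarrow> (nat \<Rightarrow> ('a list \<Rightarrow> 'a) \<Rightarrow> 'b list \<Rightarrow> 'b) \<Rightarrow> bool" where
  "minion_hom A B \<xi> \<longleftrightarrow>
     (\<forall>k\<ge>1. \<forall>f. pol A k f \<longrightarrow> pol B k (\<xi> k f)) \<and>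
     (\<forall>k\<ge>1. \<forall>m f g \<sigma>. pol A k f \<longrightarrow> pol A m g \<longrightarrow> \<sigma> ` {..<k} \<subseteq> {..<m} \<longrightarrow>
        (\<forall>xs\<in>nlists m (pverts A). g xs = f (reindex k \<sigma> xs)) \<longrightarrow>
        (\<forall>ys\<in>nlists m (pverts B). \<xi> m g ys = \<xi> k f (reindex k \<sigma> ys)))"

lemma length_reindex [simp]: "length (reindex k \<sigma> xs) = k"
  by (simp add: reindex_def)

lemma nth_reindex [simp]: "i < k \<Longrightarrow> reindex k \<sigma> xs ! i = xs ! \<sigma> i"
  by (simp add: reindex_def)

lemma nlists_iff_nth: "xs \<in> nlists k V \<longleftrightarrow> length xs = k \<and> (\<forall>i<k. xs ! i \<in> V)"
  unfolding nlists_def by (auto simp: set_conv_nth)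

lemma reindex_nlists:
  "xs \<in> nlists m V \<Longrightarrow> \<sigma> ` {..<k} \<subseteq> {..<m} \<Longrightarrow> reindex k \<sigma> xs \<in> nlists k V"
  unfolding nlists_iff_nth length_reindex by (simp add: image_subset_iff)

lemma finite_nlists: "finite V \<Longrightarrow> finite (nlists k V)"
  by (rule finite_subset[OF _ finite_lists_length_eq[of V k]]) (auto simp: nlists_def)

lemma structure_digraph_arcD:
  assumes "structure_digraph A" "(x, y) \<in> parcs A"
  shows "x \<in> pverts A" "y \<in> pverts A"
  using assms by (auto simp: structure_digraph_def dest: pair_wf_digraph.wellformed')

lemma structure_digraphI:
  "pverts A \<noteq> {} \<Longrightarrow> parcs A \<subseteq> pverts A \<times> pverts A \<Longrightarrow> structure_digraph A"
  by (auto simp: structure_digraph_def pair_wf_digraph_def)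

lemma finite_digraphI:
  assumes "finite (pverts A)" "pverts A \<noteq> {}" "parcs A \<subseteq> pverts A \<times> pverts A"
  shows "finite_digraph A"
proof -
  have s: "structure_digraph A" by (rule structure_digraphI) (use assms in auto)
  moreover have "finite (parcs A)"
    by (rule finite_subset[OF assms(3)]) (use assms in auto)
  ultimately show ?thesis
    using assms(1) by (auto simp: finite_digraph_def structure_digraph_def
        pair_fin_digraph_def pair_fin_digraph_axioms_def)
qed

lemma finite_digraphD:
  assumes "finite_digraph A"
  shows "structure_digraph A" "finite (pverts A)" "pverts A \<noteq> {}" "parcs A \<subseteq> pverts A \<times> pverts A"
proof -
  show s: "structure_digraph A" using assms by (simp add: finite_digraph_def)
  show "finite (pverts A)" "pverts A \<noteq> {}"
    using assms by (auto simp: finite_digraph_def structure_digraph_def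
        dest: pair_fin_digraph.pair_finite_verts)
  show "parcs A \<subseteq> pverts A \<times> pverts A" using structure_digraph_arcD[OF s] by auto
qed

lemma arcs_nlists:
  assumes "structure_digraph A" "length xs = k" "length ys = k" "\<And>i. i < k \<Longrightarrow> arc A (xs ! i) (ys ! i)"
  shows "xs \<in> nlists k (pverts A)" "ys \<in> nlists k (pverts A)"
  unfolding nlists_iff_nth using assms structure_digraph_arcD[OF assms(1) assms(4)] by auto

lemma polI:
  assumes "\<And>xs. xs \<in> nlists k (pverts A) \<Longrightarrow> f xs \<in> pverts A"
    and "\<And>xs ys. length xs = k \<Longrightarrow> length ys = k \<Longrightarrow> (\<And>i. i < k \<Longrightarrow> arc A (xs ! i) (ys ! i)) \<Longrightarrow> arc A (f xs) (f ys)"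
  shows "pol A k f"
  using assms by (auto simp: pol_def list_all2_conv_all_nth)

lemma pol_arc:
  "pol A k f \<Longrightarrow> length xs = k \<Longrightarrow> length ys = k \<Longrightarrow> (\<And>i. i < k \<Longrightarrow> arc A (xs ! i) (ys ! i)) \<Longrightarrow> arc A (f xs) (f ys)"
  by (auto simp: pol_def list_all2_conv_all_nth)

lemma pol_in: "pol A k f \<Longrightarrow> xs \<in> nlists k (pverts A) \<Longrightarrow> f xs \<in> pverts A"
  by (simp add: pol_def)

lemma pol_cong:
  assumes "structure_digraph A" "pol A k f" "\<And>xs. xs \<in> nlists k (pverts A) \<Longrightarrow> g xs = f xs"
  shows "pol A k g"
proof (rule polI)
  fix xs assume "xs \<in> nlists k (pverts A)"
  then show "g xs \<in> pverts A" using assms(3) pol_in[OF assms(2)] by simp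
next
  fix xs ys assume l: "length xs = k" "length ys = k" and a: "\<And>i. i < k \<Longrightarrow> arc A (xs ! i) (ys ! i)"
  from arcs_nlists[OF assms(1) this]
  have "xs \<in> nlists k (pverts A)" "ys \<in> nlists k (pverts A)" by auto
  then show "arc A (g xs) (g ys)" using assms(3) pol_arc[OF assms(2) l a] by simp
qed

lemma pol_reindex:
  assumes "pol A k f" "\<sigma> ` {..<k} \<subseteq> {..<m}"
  shows "pol A m (\<lambda>xs. f (reindex k \<sigma> xs))"
proof (rule polI)
  fix xs assume "xs \<in> nlists m (pverts A)"
  then show "f (reindex k \<sigma> xs) \<in> pverts A"
    by (intro pol_in[OF assms(1)] reindex_nlists[OF _ assms(2)])
next
  fix xs ys assume "\<And>i. i < m \<Longrightarrow> arc A (xs ! i) (ys ! i)"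
  then show "arc A (f (reindex k \<sigma> xs)) (f (reindex k \<sigma> ys))"
    using assms(2) by (intro pol_arc[OF assms(1)]) (simp_all add: image_subset_iff)
qed

section \<open>Preservation of pp formulas by polymorphisms\<close>

lemma satisfies_cong:
  "(\<And>z. z \<in> free_vars \<phi> \<Longrightarrow> u z = v z) \<Longrightarrow> satisfies A u \<phi> \<longleftrightarrow> satisfies A v \<phi>"
proof (induction \<phi> arbitrary: u v)
  case (And \<phi> \<psi>)
  then show ?case by (metis UnI1 UnI2 free_vars.simps(4) satisfies.simps(4))
next
  case (Exi x \<phi>)
  have "satisfies A (u(x := a)) \<phi> \<longleftrightarrow> satisfies A (v(x := a)) \<phi>" for a
    by (rule Exi.IH) (use Exi.prems in auto)
  then show ?case by simp
qed auto

text \<open>The easy half of the Galois connection between pp-definable relations and polymorphisms: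
  \<open>f\<close> is applied to \<open>k\<close> satisfying assignments variable by variable, and
  it merges the \<open>k\<close> witnesses of a quantifier into one.\<close>

lemma satisfies_pol:
  assumes f: "pol A k f" "k \<ge> 1"
  shows "(\<And>i. i < k \<Longrightarrow> satisfies A (v i) \<phi>) \<Longrightarrow> satisfies A (\<lambda>z. f (map (\<lambda>i. v i z) [0..<k])) \<phi>"
proof (induction \<phi> arbitrary: v)
  case Bot
  \<comment> \<open>As \<open>k \<ge> 1\<close>, there is an assignment with index 0, and it would
    have to satisfy \<open>Bot\<close>.\<close>
  then show ?case using f(2) by (auto dest: spec[of _ 0])
next
  case (Rel x y)
  then show ?case by (auto intro!: pol_arc[OF f(1)])
next
  case (Equ x y)
  then have "map (\<lambda>i. v i x) [0..<k] = map (\<lambda>i. v i y) [0..<k]" by simp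
  then show ?case by (simp only: satisfies.simps)
next
  case (And \<phi> \<psi>)
  then show ?case by simp
next
  case (Exi x \<phi>)
  have "\<forall>i. \<exists>a. i < k \<longrightarrow> a \<in> pverts A \<and> satisfies A ((v i)(x := a)) \<phi>"
    using Exi.prems by auto
  then obtain a where a: "\<And>i. i < k \<Longrightarrow> a i \<in> pverts A \<and> satisfies A ((v i)(x := a i)) \<phi>"
    by metis
  let ?b = "f (map a [0..<k])"
  have "satisfies A (\<lambda>z. f (map (\<lambda>i. ((v i)(x := a i)) z) [0..<k])) \<phi>"
    by (rule Exi.IH[of "\<lambda>i. (v i)(x := a i)"]) (rule conjunct2[OF a])
  also have "(\<lambda>z. f (map (\<lambda>i. ((v i)(x := a i)) z) [0..<k])) =
      (\<lambda>z. f (map (\<lambda>i. v i z) [0..<k]))(x := ?b)"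
    by (auto simp: fun_eq_iff)
  finally have "satisfies A \<dots> \<phi>" .
  moreover have "?b \<in> pverts A"
    by (rule pol_in[OF f(1)]) (use a in \<open>auto simp: nlists_iff_nth\<close>)
  ultimately show ?case by auto
qed

section \<open>Homomorphic equivalence\<close>

text \<open>A library isomorphism has separate maps for vertices, arcs, heads and tails. Comparison
  with \<open>with_proj P\<close> forces the last two to be \<open>snd\<close> and
  \<open>fst\<close>, so arcs move as pairs of vertices.\<close>

lemma digraph_iso_homs:
  assumes "structure_digraph Q" "digraph_iso (with_proj Q) (with_proj P)"
  shows "hom_equivalent Q P"
proof -
  from assms(2) obtain h where h: "pre_digraph.digraph_isomorphism (with_proj Q) h"
    and P: "with_proj P = app_iso h (with_proj Q)"
    by (auto simp: digraph_iso_def)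
  let ?f = "iso_verts h"
  have v: "pverts P = ?f ` pverts Q" and a: "parcs P = iso_arcs h ` parcs Q"
    and t: "iso_tail h = fst" and hd: "iso_head h = snd"
    using arg_cong[OF P, of verts] arg_cong[OF P, of arcs] arg_cong[OF P, of tail]
      arg_cong[OF P, of head] by auto
  have inj: "inj_on ?f (pverts Q)"
    using pre_digraph.digraph_isomorphism_inj_on_verts[OF h] by simp
  have ia: "iso_arcs h e = (?f (fst e), ?f (snd e))" if "e \<in> parcs Q" for e
    using pre_digraph.iso_verts_tail[OF h, of e] pre_digraph.iso_verts_head[OF h, of e] that t hd
    by (auto simp: prod_eq_iff)
  have "digraph_hom Q P ?f"
    unfolding digraph_hom_def v a using ia by force
  moreover have "digraph_hom P Q (the_inv_into (pverts Q) ?f)"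
    unfolding digraph_hom_def v a using ia structure_digraph_arcD[OF assms(1)]
    by (auto simp: the_inv_into_f_f[OF inj])
  ultimately show ?thesis by (auto simp: hom_equivalent_def)
qed

lemma digraph_hom_comp:
  "digraph_hom A B f \<Longrightarrow> digraph_hom B C g \<Longrightarrow> digraph_hom A C (g \<circ> f)"
  unfolding digraph_hom_def by (auto simp: image_subset_iff)

lemma hom_equivalent_trans:
  "hom_equivalent A B \<Longrightarrow> hom_equivalent B C \<Longrightarrow> hom_equivalent A C"
  unfolding hom_equivalent_def by (meson digraph_hom_comp)

lemma hom_equivalent_sym: "hom_equivalent A B \<Longrightarrow> hom_equivalent B A"
  by (auto simp: hom_equivalent_def)

lemma digraph_iso_refl:
  assumes "structure_digraph Q"
  shows "digraph_iso (with_proj Q) (with_proj Q)"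
proof -
  let ?h = "\<lparr>iso_verts = id, iso_arcs = id, iso_head = snd, iso_tail = fst\<rparr>"
  have "pre_digraph.digraph_isomorphism (with_proj Q) ?h"
    using assms by (simp add: pre_digraph.digraph_isomorphism_def wf_digraph_wp_iff structure_digraph_def)
  moreover have "with_proj Q = app_iso ?h (with_proj Q)"
    by (simp add: app_iso_def with_proj_def)
  ultimately show ?thesis unfolding digraph_iso_def by blast
qed

lemma pp_constructs_cong_right:
  "A \<le>\<^sub>p\<^sub>p B \<Longrightarrow> hom_equivalent B C \<Longrightarrow> A \<le>\<^sub>p\<^sub>p C"
  unfolding pp_constructs_def by (meson hom_equivalent_sym hom_equivalent_trans)

text \<open>Polymorphisms of \<open>A\<close> act coordinatewise on tuples and preserve the
  pp-definable arcs of \<open>Q\<close>. Going from \<open>B\<close> to \<open>Q\<close> by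
  \<open>s\<close>, acting there and returning by \<open>r\<close> yields polymorphisms of
  \<open>B\<close>, compatibly with minors.\<close>

lemma pp_constructs_imp_minion_hom:
  fixes A :: "'a pair_pre_digraph" and B :: "'b pair_pre_digraph"
  assumes A: "structure_digraph A" and B: "structure_digraph B" and le: "A \<le>\<^sub>p\<^sub>p B"
  shows "\<exists>\<xi>. minion_hom A B \<xi>"
proof -
  from le obtain P :: "'a list pair_pre_digraph" where P: "pp_power A P" "hom_equivalent B P"
    by (auto simp: pp_constructs_def)
  then obtain n and Q :: "'a list pair_pre_digraph"
    where n: "n \<ge> 1" and Q: "structure_digraph Q" "pverts Q = nlists n (pverts A)"
      "pp_definable A (2 * n) {xs @ ys | xs ys. (xs, ys) \<in> parcs Q}"
      "digraph_iso (with_proj Q) (with_proj P)"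
    by (auto simp: pp_power_def)
  have "hom_equivalent B Q"
    using P(2) digraph_iso_homs[OF Q(1,4)] hom_equivalent_sym hom_equivalent_trans by metis
  then obtain s r where s: "digraph_hom B Q s" and r: "digraph_hom Q B r"
    by (auto simp: hom_equivalent_def)
  obtain \<phi> where \<phi>: "free_vars \<phi> \<subseteq> {..<2*n}"
    and R: "{xs @ ys | xs ys. (xs, ys) \<in> parcs Q} = {xs \<in> nlists (2*n) (pverts A). satisfies A (nth xs) \<phi>}"
    using Q(3) by (auto simp: pp_definable_def)
  define F :: "('a list \<Rightarrow> 'a) \<Rightarrow> 'b list \<Rightarrow> 'a list" where "F f ys = map (\<lambda>j. f (map (\<lambda>y. s y ! j) ys)) [0..<n]" for f ys
  define \<xi> where "\<xi> = (\<lambda>(k::nat) f ys. r (F f ys))"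
  have sV: "s y \<in> nlists n (pverts A)" if "y \<in> pverts B" for y
    using s that Q(2) by (auto simp: digraph_hom_def)
  have row: "map (\<lambda>y. s y ! j) ys \<in> nlists k (pverts A)" if "ys \<in> nlists k (pverts B)" "j < n" for ys j k
    using that sV by (auto simp: nlists_iff_nth)
  have FV: "F f ys \<in> nlists n (pverts A)" if "pol A k f" "ys \<in> nlists k (pverts B)" for f k ys
    unfolding nlists_iff_nth[of _ n] F_def using pol_in[OF that(1) row[OF that(2)]] by simp
  have pol: "pol B k (\<xi> k f)" if k: "k \<ge> 1" and f: "pol A k f" for k f
  proof (rule polI)
    fix xs assume "xs \<in> nlists k (pverts B)"
    then show "\<xi> k f xs \<in> pverts B"
      using FV[OF f] r Q(2) by (auto simp: \<xi>_def digraph_hom_def)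
  next
    fix xs ys assume l: "length xs = k" "length ys = k" and arcs: "\<And>i. i < k \<Longrightarrow> arc B (xs ! i) (ys ! i)"
    note mem = arcs_nlists[OF B l arcs]
    have "arc Q (s (xs ! i)) (s (ys ! i))" if "i < k" for i
      using s arcs[OF that] by (auto simp: digraph_hom_def)
    then have "s (xs ! i) @ s (ys ! i) \<in> {xs @ ys | xs ys. (xs, ys) \<in> parcs Q}" if "i < k" for i
      using that by blast
    then have "satisfies A (nth (s (xs ! i) @ s (ys ! i))) \<phi>" if "i < k" for i
      unfolding R using that by blast
    from satisfies_pol[OF f k, of "\<lambda>i. nth (s (xs ! i) @ s (ys ! i))", OF this]
    have "satisfies A (\<lambda>z. f (map (\<lambda>i. (s (xs ! i) @ s (ys ! i)) ! z) [0..<k])) \<phi>" .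
    also have "?this \<longleftrightarrow> satisfies A (nth (F f xs @ F f ys)) \<phi>"
    proof (rule satisfies_cong)
      fix z assume "z \<in> free_vars \<phi>"
      then have z: "z < 2 * n" using \<phi> by auto
      have len: "length (s (xs ! i)) = n" if "i < k" for i
        using that mem sV by (auto simp: nlists_iff_nth)
      show "f (map (\<lambda>i. (s (xs ! i) @ s (ys ! i)) ! z) [0..<k]) = (F f xs @ F f ys) ! z"
      proof (cases "z < n")
        case True
        then have "map (\<lambda>i. (s (xs ! i) @ s (ys ! i)) ! z) [0..<k] = map (\<lambda>y. s y ! z) xs"
          using len l by (intro nth_equalityI) (simp_all add: nth_append)
        then show ?thesis using True by (simp add: F_def nth_append)
      next
        case False
        then have "map (\<lambda>i. (s (xs ! i) @ s (ys ! i)) ! z) [0..<k] = map (\<lambda>y. s y ! (z - n)) ys"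
          using len l by (intro nth_equalityI) (simp_all add: nth_append)
        moreover have "z - n < n" using z by simp
        ultimately show ?thesis using False by (simp add: F_def nth_append)
      qed
    qed
    finally have "F f xs @ F f ys \<in> {xs @ ys | xs ys. (xs, ys) \<in> parcs Q}"
      unfolding R using nlists_appendI[OF FV[OF f mem(1)] FV[OF f mem(2)]] by (simp add: mult_2)
    then obtain a b where ab: "F f xs @ F f ys = a @ b" "(a, b) \<in> parcs Q" by blast
    have "length a = n" 
      using structure_digraph_arcD(1)[OF Q(1) ab(2)] unfolding Q(2) by (rule nlistsE_length)
    moreover have "length (F f xs) = n" by (simp add: F_def)
    ultimately have "F f xs = a" "F f ys = b" using ab(1) by simp_all
    then show "arc B (\<xi> k f xs) (\<xi> k f ys)"
      using ab(2) r by (auto simp: \<xi>_def digraph_hom_def)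
  qed
  have minor: "\<xi> m g ys = \<xi> k f (reindex k \<sigma> ys)"
    if "k \<ge> 1" "pol A k f" "pol A m g" and \<sigma>: "\<sigma> ` {..<k} \<subseteq> {..<m}"
      and eq: "\<forall>xs\<in>nlists m (pverts A). g xs = f (reindex k \<sigma> xs)" and ys: "ys \<in> nlists m (pverts B)"
    for k m f g \<sigma> ys
  proof -
    have "g (map (\<lambda>y. s y ! j) ys) = f (map (\<lambda>y. s y ! j) (reindex k \<sigma> ys))" if "j < n" for j
    proof -
      have "reindex k \<sigma> (map (\<lambda>y. s y ! j) ys) = map (\<lambda>y. s y ! j) (reindex k \<sigma> ys)"
        using \<sigma> nlistsE_length[OF ys] by (intro nth_equalityI) (simp_all add: image_subset_iff)
      then show ?thesis using bspec[OF eq row[OF ys that]] by simp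
    qed
    then have "F g ys = F f (reindex k \<sigma> ys)" unfolding F_def by (intro map_cong) simp_all
    then show ?thesis by (simp add: \<xi>_def)
  qed
  have "minion_hom A B \<xi>"
    unfolding minion_hom_def using pol minor by simp
  then show ?thesis by blast
qed

section \<open>The free digraph of a minion\<close>

text \<open>The empty conjunction has to be an atom, and \<open>Equ 0 0\<close> serves as truth;
  hence variable 0 always counts as free.\<close>

primrec conjunction :: "pp_formula list \<Rightarrow> pp_formula" where
  "conjunction [] = Equ 0 0"
| "conjunction (\<psi> # \<psi>s) = And \<psi> (conjunction \<psi>s)"

primrec exists_block :: "nat \<Rightarrow> nat \<Rightarrow> pp_formula \<Rightarrow> pp_formula" where
  "exists_block a 0 \<phi> = \<phi>"
| "exists_block a (Suc m) \<phi> = Exi (a + m) (exists_block a m \<phi>)"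

lemma free_vars_conjunction: "free_vars (conjunction \<psi>s) = insert 0 (\<Union>(free_vars ` set \<psi>s))"
  by (induction \<psi>s) auto

lemma satisfies_conjunction: "satisfies A v (conjunction \<psi>s) \<longleftrightarrow> (\<forall>\<psi>\<in>set \<psi>s. satisfies A v \<psi>)"
  by (induction \<psi>s) auto

lemma free_vars_exists_block: "free_vars (exists_block a m \<phi>) = free_vars \<phi> - {a..<a+m}"
proof (induction m)
  case (Suc m)
  have eq: "{a..<a+Suc m} = insert (a + m) {a..<a+m}" by auto
  show ?case unfolding exists_block.simps free_vars.simps Suc.IH eq by (rule Diff_insert[symmetric])
qed simp

lemma satisfies_exists_block:
  "satisfies A v (exists_block a m \<phi>) \<longleftrightarrow>
    (\<exists>u. (\<forall>z\<in>{a..<a+m}. u z \<in> pverts A) \<and> (\<forall>z. z \<notin> {a..<a+m} \<longrightarrow> u z = v z) \<and> satisfies A u \<phi>)"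
proof (induction m arbitrary: v)
  case 0
  show ?case by (simp flip: fun_eq_iff)
next
  case (Suc m)
  show ?case (is "?l \<longleftrightarrow> ?r")
  proof
    assume ?l
    then obtain b where b: "b \<in> pverts A" "satisfies A (v(a + m := b)) (exists_block a m \<phi>)"
      by auto
    from b(2)[unfolded Suc.IH] obtain u where "\<forall>z\<in>{a..<a+m}. u z \<in> pverts A"
      "\<forall>z. z \<notin> {a..<a+m} \<longrightarrow> u z = (v(a + m := b)) z" "satisfies A u \<phi>"
      by (elim exE conjE)
    then show ?r using b(1) by (intro exI[of _ u]) (auto simp: less_Suc_eq)
  next
    assume ?r
    then obtain u where u: "\<forall>z\<in>{a..<a+Suc m}. u z \<in> pverts A"
      "\<forall>z. z \<notin> {a..<a+Suc m} \<longrightarrow> u z = v z" "satisfies A u \<phi>"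
      by (elim exE conjE)
    then have "satisfies A (v(a + m := u (a + m))) (exists_block a m \<phi>)"
      unfolding Suc.IH by (intro exI[of _ u]) (auto simp: less_Suc_eq)
    then show ?l using u(1) by auto
  qed
qed

text \<open>
  The free digraph generated by \<open>B\<close> in the minion of polymorphisms of \<open>A\<close>: its vertices are
  \<open>B\<close>-ary polymorphisms of \<open>A\<close>, and the two minors of an arc-ary polymorphism along source
  and target are joined by an arc. It is a pp-power of \<open>A\<close> (a polymorphism being listed as its
  table of values), so only a homomorphism \<open>g\<close> back to \<open>B\<close> is needed.
\<close>

lemma pp_constructsI_free:
  fixes A :: "'a pair_pre_digraph" and B :: "'b pair_pre_digraph"
  assumes A: "finite_digraph A" and B: "structure_digraph B"
    and bs: "distinct bs" "set bs = pverts B"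
    and es: "\<And>i j. (i, j) \<in> set es \<Longrightarrow> i < length bs \<and> j < length bs"
      "parcs B = (\<lambda>(i, j). (bs ! i, bs ! j)) ` set es"
    and g: "\<And>F. pol A (length bs) F \<Longrightarrow> g F \<in> pverts B"
      "\<And>h F F'. es \<noteq> [] \<Longrightarrow> pol A (length es) h \<Longrightarrow> pol A (length bs) F \<Longrightarrow> pol A (length bs) F' \<Longrightarrow>
         (\<And>x. x \<in> nlists (length bs) (pverts A) \<Longrightarrow> F x = h (map (\<lambda>(i, j). x ! i) es)) \<Longrightarrow>
         (\<And>x. x \<in> nlists (length bs) (pverts A) \<Longrightarrow> F' x = h (map (\<lambda>(i, j). x ! j) es)) \<Longrightarrow>
         arc B (g F) (g F')"
  shows "A \<le>\<^sub>p\<^sub>p B"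
proof -
  note fA = finite_digraphD[OF A]
  define V where "V = pverts A"
  \<comment> \<open>\<open>X\<close> and \<open>Y\<close> hold the argument lists of the vertex-ary
    and of the arc-ary operations on \<open>A\<close>. Numbering \<open>X\<close> turns a vertex-ary
    operation into a tuple of length \<open>n\<close>.\<close>
  define X where "X = nlists (length bs) V"
  define Y where "Y = nlists (length es) V"
  define n where "n = card X"
  define M where "M = card Y"
  have fin: "finite X" "finite Y" using fA(2) by (simp_all add: X_def Y_def V_def finite_nlists)
  obtain eX where eX: "bij_betw eX X {0..<n}"
    using ex_bij_betw_finite_nat[OF fin(1)] unfolding n_def by blast
  obtain eY where eY: "bij_betw eY Y {0..<M}"
    using ex_bij_betw_finite_nat[OF fin(2)] unfolding M_def by blast
  have eXn: "eX x < n" if "x \<in> X" for x using bij_betwE[OF eX] that by auto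
  have eYM: "eY y < M" if "y \<in> Y" for y using bij_betwE[OF eY] that by auto
  have n1: "n \<ge> 1"
    using nlists_not_empty[OF fA(3), of "length bs"] fin(1)
    unfolding n_def X_def V_def by (simp add: Suc_le_eq card_gt_0_iff) blast
  \<comment> \<open>Precomposing an arc-ary operation with \<open>src\<close> and \<open>tgt\<close>
    gives its minors along source and target.\<close>
  define src :: "'a list \<Rightarrow> 'a list" where "src x = map (\<lambda>(i, j). x ! i) es" for x
  define tgt :: "'a list \<Rightarrow> 'a list" where "tgt x = map (\<lambda>(i, j). x ! j) es" for x
  have srcY: "src x \<in> Y" "tgt x \<in> Y" if "x \<in> X" for x
  proof -
    have "x ! i \<in> V" "x ! j \<in> V" if "(i, j) \<in> set es" for i j
      using es(1)[OF that] \<open>x \<in> X\<close> by (auto simp: X_def nlists_iff_nth)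
    then show "src x \<in> Y" "tgt x \<in> Y"
      unfolding Y_def nlists_iff_nth src_def tgt_def using nth_mem by (fastforce split: prod.split)+
  qed
  \<comment> \<open>Variables below \<open>n\<close> hold the first table, the next \<open>n\<close>
    the second, and those from \<open>2 * n\<close> on the table of an arc-ary operation. The
    equations make the two tables its minors, the \<open>Rel\<close> atoms make it preserve arcs. If
    \<open>B\<close> has no arcs, \<open>Bot\<close> keeps nullary operations from creating
    any.\<close>
  define S where "S = (if es = [] then {Bot} else {})
      \<union> (\<lambda>x. Equ (eX x) (2 * n + eY (src x))) ` X
      \<union> (\<lambda>x. Equ (n + eX x) (2 * n + eY (tgt x))) ` X
      \<union> (\<lambda>(y, y'). Rel (2 * n + eY y) (2 * n + eY y')) ` {(y, y') \<in> Y \<times> Y. list_all2 (arc A) y y'}"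
  have "finite S" unfolding S_def using fin
    by (auto intro!: finite_imageI intro: finite_subset[OF _ finite_cartesian_product[OF fin(2) fin(2)]])
  then obtain \<psi>s where \<psi>s: "set \<psi>s = S" using finite_list by blast
  define \<psi> where "\<psi> = conjunction \<psi>s"
  have \<psi>: "free_vars \<psi> = insert 0 (\<Union>(free_vars ` S))"
    "\<And>v. satisfies A v \<psi> \<longleftrightarrow> (\<forall>\<psi>\<in>S. satisfies A v \<psi>)"
    by (simp_all add: \<psi>_def \<psi>s free_vars_conjunction satisfies_conjunction)
  define \<phi> where "\<phi> = exists_block (2*n) M \<psi>"
  have \<phi>: "free_vars \<phi> = free_vars \<psi> - {2*n..<2*n+M}"
    "\<And>v. satisfies A v \<phi> \<longleftrightarrow> (\<exists>u. (\<forall>z\<in>{2*n..<2*n+M}. u z \<in> V) \<and>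
        (\<forall>z. z \<notin> {2*n..<2*n+M} \<longrightarrow> u z = v z) \<and> satisfies A u \<psi>)"
    by (simp_all only: \<phi>_def V_def free_vars_exists_block satisfies_exists_block)
  have "free_vars \<psi> \<subseteq> {..<2*n+M}"
  proof
    fix z assume "z \<in> free_vars \<psi>"
    with \<psi>(1) consider "z = 0" | a where "a \<in> S" "z \<in> free_vars a" by auto
    then show "z \<in> {..<2*n+M}"
    proof cases
      case 1
      then show ?thesis using n1 by simp
    next
      case 2
      from 2(1) consider "a = Bot" | x where "x \<in> X" "a = Equ (eX x) (2 * n + eY (src x))"
        | x where "x \<in> X" "a = Equ (n + eX x) (2 * n + eY (tgt x))"
        | y y' where "y \<in> Y" "y' \<in> Y" "a = Rel (2 * n + eY y) (2 * n + eY y')"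
        unfolding S_def by (auto split: if_splits)
      then show ?thesis
      proof cases
        case 1
        then show ?thesis using 2(2) by simp
      next
        case (2 x)
        then show ?thesis using \<open>z \<in> free_vars a\<close> eXn[of x] eYM[OF srcY(1)[of x]] by auto
      next
        case (3 x)
        then show ?thesis using \<open>z \<in> free_vars a\<close> eXn[of x] eYM[OF srcY(2)[of x]] by auto
      next
        case (4 y y')
        then show ?thesis using \<open>z \<in> free_vars a\<close> eYM[of y] eYM[of y'] by auto
      qed
    qed
  qed
  then have fv: "free_vars \<phi> \<subseteq> {..<2*n}" using \<phi>(1) by auto
  define Q :: "'a list pair_pre_digraph" where
    "Q = \<lparr>pverts = nlists n V, parcs = {(t, t'). t \<in> nlists n V \<and> t' \<in> nlists n V \<and> satisfies A (nth (t @ t')) \<phi>}\<rparr>"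
  have Q: "structure_digraph Q"
    by (rule structure_digraphI) (use nlists_not_empty[OF fA(3)] in \<open>auto simp: Q_def V_def\<close>)
  \<comment> \<open>On \<open>Y\<close>, \<open>w\<close> is an arc-ary polymorphism whose two
    minors are tabulated by \<open>t\<close> and \<open>t'\<close>.\<close>
  define wit where "wit w t t' \<longleftrightarrow> (\<forall>y\<in>Y. w y \<in> V) \<and>
      (\<forall>y\<in>Y. \<forall>y'\<in>Y. list_all2 (arc A) y y' \<longrightarrow> arc A (w y) (w y')) \<and>
      (\<forall>x\<in>X. t ! eX x = w (src x)) \<and> (\<forall>x\<in>X. t' ! eX x = w (tgt x))" for w t t'
  have witD: "\<And>y. y \<in> Y \<Longrightarrow> w y \<in> V"
      "\<And>y y'. y \<in> Y \<Longrightarrow> y' \<in> Y \<Longrightarrow> list_all2 (arc A) y y' \<Longrightarrow> arc A (w y) (w y')"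
      "\<And>x. x \<in> X \<Longrightarrow> t ! eX x = w (src x)" "\<And>x. x \<in> X \<Longrightarrow> t' ! eX x = w (tgt x)"
    if "wit w t t'" for w t t'
    using that unfolding wit_def by simp_all
  have arcQ: "arc Q t t' \<longleftrightarrow> es \<noteq> [] \<and> t \<in> nlists n V \<and> t' \<in> nlists n V \<and> (\<exists>w. wit w t t')" (is "_ \<longleftrightarrow> ?R") for t t'
  proof
    assume a: "arc Q t t'"
    then have t: "t \<in> nlists n V" "t' \<in> nlists n V" "satisfies A (nth (t @ t')) \<phi>" by (auto simp: Q_def)
    then obtain u where u: "\<forall>z\<in>{2*n..<2*n+M}. u z \<in> V"
      "\<forall>z. z \<notin> {2*n..<2*n+M} \<longrightarrow> u z = (t @ t') ! z" and uS: "\<And>a. a \<in> S \<Longrightarrow> satisfies A u a"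
      using iffD1[OF \<phi>(2) t(3)] unfolding \<psi>(2) by (elim exE conjE) simp
    have ne: "es \<noteq> []" using uS[of Bot] by (auto simp: S_def)
    have lt: "length t = n" "length t' = n" using t nlistsE_length by blast+
    define w where "w y = u (2 * n + eY y)" for y
    have "\<forall>y\<in>Y. w y \<in> V" using u(1) eYM by (simp add: w_def)
    moreover have "arc A (w y) (w y')" if "y \<in> Y" "y' \<in> Y" "list_all2 (arc A) y y'" for y y'
    proof -
      have "Rel (2 * n + eY y) (2 * n + eY y') \<in> S"
        unfolding S_def using that by (intro UnI2 image_eqI[of _ _ "(y, y')"]) simp_all
      from uS[OF this] show ?thesis by (simp add: w_def)
    qed
    moreover have "t ! eX x = w (src x)" if "x \<in> X" for x
    proof -
      have "Equ (eX x) (2 * n + eY (src x)) \<in> S" using that by (auto simp: S_def)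
      from uS[OF this] show ?thesis
        using u(2)[rule_format, of "eX x"] eXn[OF that] lt by (simp add: w_def nth_append)
    qed
    moreover have "t' ! eX x = w (tgt x)" if "x \<in> X" for x
    proof -
      have "Equ (n + eX x) (2 * n + eY (tgt x)) \<in> S" using that by (auto simp: S_def)
      from uS[OF this] show ?thesis
        using u(2)[rule_format, of "n + eX x"] eXn[OF that] lt by (simp add: w_def nth_append)
    qed
    ultimately have "wit w t t'" by (simp add: wit_def)
    then show ?R using ne t(1,2) by blast
  next
    assume ?R
    then obtain w where ne: "es \<noteq> []" and t: "t \<in> nlists n V" "t' \<in> nlists n V" and "wit w t t'"
      by blast
    note w = witD[OF this(4)]
    have lt: "length t = n" "length t' = n" using t nlistsE_length by blast+
    define u where "u z = (if z \<in> {2*n..<2*n+M} then w (inv_into Y eY (z - 2 * n)) else (t @ t') ! z)" for z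
    have uY: "u (2 * n + eY y) = w y" if "y \<in> Y" for y
      using eYM[OF that] that bij_betw_inv_into_left[OF eY that] by (simp add: u_def)
    have u1: "\<forall>z\<in>{2*n..<2*n+M}. u z \<in> V"
      using w(1) bij_betwE[OF bij_betw_inv_into[OF eY]] by (auto simp: u_def)
    have u2: "u z = (t @ t') ! z" if "z \<notin> {2*n..<2*n+M}" for z unfolding u_def if_not_P[OF that] by (rule refl)
    have "satisfies A u a" if "a \<in> S" for a
    proof -
      from that ne consider x where "x \<in> X" "a = Equ (eX x) (2 * n + eY (src x))"
        | x where "x \<in> X" "a = Equ (n + eX x) (2 * n + eY (tgt x))"
        | y y' where "y \<in> Y" "y' \<in> Y" "list_all2 (arc A) y y'" "a = Rel (2 * n + eY y) (2 * n + eY y')"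
        unfolding S_def by auto
      then show ?thesis
      proof cases
        case 1
        have "u (eX x) = t ! eX x" using u2[of "eX x"] eXn[OF 1(1)] lt by (simp add: nth_append)
        then show ?thesis using 1 w(3) uY srcY by simp
      next
        case 2
        have "u (n + eX x) = t' ! eX x" using u2[of "n + eX x"] eXn[OF 2(1)] lt by (simp add: nth_append)
        then show ?thesis using 2 w(4) uY srcY by simp
      next
        case 3
        then show ?thesis using w(2) uY by simp
      qed
    qed
    then have "satisfies A (nth (t @ t')) \<phi>" unfolding \<phi>(2) \<psi>(2) using u1 u2 by blast
    then show "arc Q t t'" using t by (simp add: Q_def)
  qed
  have power: "pp_power A Q"
    unfolding pp_power_def
  proof (intro exI conjI)
    show "1 \<le> n" "structure_digraph Q" by fact+
    show "pverts Q = nlists n (pverts A)" by (simp add: Q_def V_def)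
    show "digraph_iso (with_proj Q) (with_proj Q)" by (rule digraph_iso_refl) fact
    have "{xs @ ys | xs ys. (xs, ys) \<in> parcs Q} = {xs \<in> nlists (2 * n) (pverts A). satisfies A (nth xs) \<phi>}"
      (is "?L = ?R")
    proof
      show "?L \<subseteq> ?R" using nlists_appendI[of _ n V _ n] by (auto simp: Q_def V_def mult_2)
      show "?R \<subseteq> ?L"
      proof
        fix xs assume xs: "xs \<in> ?R"
        then have "xs \<in> nlists (n + n) V" by (simp add: V_def mult_2)
        then have "take n xs \<in> nlists n V" "drop n xs \<in> nlists n V"
          by (auto simp: nlists_iff_nth)
        then have "arc Q (take n xs) (drop n xs)" using xs by (simp add: Q_def)
        moreover have "xs = take n xs @ drop n xs" by simp
        ultimately show "xs \<in> ?L" by blast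
      qed
    qed
    then show "pp_definable A (2 * n) {xs @ ys | xs ys. (xs, ys) \<in> parcs Q}"
      unfolding pp_definable_def using fv by blast
  qed
  define F :: "'a list \<Rightarrow> 'a list \<Rightarrow> 'a" where "F t x = t ! eX x" for t x
  obtain b0 where b0: "b0 \<in> pverts B" using B unfolding structure_digraph_def by blast
  \<comment> \<open>Every tuple is a vertex of \<open>Q\<close>, even if it is not the table of a
    polymorphism. Such tuples lie on no arc, so all of them may go to \<open>b0\<close>.\<close>
  have "digraph_hom Q B (\<lambda>t. if pol A (length bs) (F t) then g (F t) else b0)"
    unfolding digraph_hom_def
  proof (intro conjI allI impI)
    fix t t' assume "arc Q t t'"
    then obtain w where ne: "es \<noteq> []" and "wit w t t'" unfolding arcQ by blast
    note w = witD[OF this(2)]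
    have wp: "pol A (length es) w"
    proof (rule polI)
      fix y assume "y \<in> nlists (length es) (pverts A)"
      then show "w y \<in> pverts A" using w(1) by (simp add: Y_def V_def)
    next
      fix y y' assume l: "length y = length es" "length y' = length es"
        and a: "\<And>i. i < length es \<Longrightarrow> arc A (y ! i) (y' ! i)"
      then have "list_all2 (arc A) y y'" by (simp add: list_all2_conv_all_nth)
      then show "arc A (w y) (w y')"
        using w(2) arcs_nlists[OF fA(1) l a] by (simp add: Y_def V_def)
    qed
    have eqs: "\<And>x. x \<in> nlists (length bs) (pverts A) \<Longrightarrow> F t x = w (src x)"
      "\<And>x. x \<in> nlists (length bs) (pverts A) \<Longrightarrow> F t' x = w (tgt x)"
      using w(3,4) by (simp_all add: F_def X_def V_def)
    have "src x = reindex (length es) (\<lambda>e. fst (es ! e)) x" "tgt x = reindex (length es) (\<lambda>e. snd (es ! e)) x" for x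
      by (simp_all add: src_def tgt_def list_eq_iff_nth_eq case_prod_beta)
    moreover have "(\<lambda>e. fst (es ! e)) ` {..<length es} \<subseteq> {..<length bs}" "(\<lambda>e. snd (es ! e)) ` {..<length es} \<subseteq> {..<length bs}"
      using es(1)[of "fst (es ! e)" "snd (es ! e)" for e] by auto
    ultimately have "pol A (length bs) (\<lambda>x. w (src x))" "pol A (length bs) (\<lambda>x. w (tgt x))"
      using pol_reindex[OF wp] by simp_all
    then have Fp: "pol A (length bs) (F t)" "pol A (length bs) (F t')"
      using pol_cong[OF fA(1) _ eqs(1)] pol_cong[OF fA(1) _ eqs(2)] by simp_all
    then show "arc B (if pol A (length bs) (F t) then g (F t) else b0)
        (if pol A (length bs) (F t') then g (F t') else b0)"
      using g(2)[OF ne wp Fp eqs(1)[unfolded src_def] eqs(2)[unfolded tgt_def]] by simp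
  next
    show "(\<lambda>t. if pol A (length bs) (F t) then g (F t) else b0) ` pverts Q \<subseteq> pverts B"
      using g(1) b0 by (intro image_subsetI) simp
  qed
  moreover
  define ix where "ix b = (THE i. i < length bs \<and> bs ! i = b)" for b
  have ix: "ix (bs ! i) = i" if "i < length bs" for i
    unfolding ix_def using that nth_eq_iff_index_eq[OF bs(1)] by (intro the_equality) auto
  \<comment> \<open>\<open>\<pi> b\<close> is the table of the projection to the position of
    \<open>b\<close>. An arc of \<open>B\<close> at position \<open>e\<close> of \<open>es\<close>
    will be witnessed by the projection to \<open>e\<close>.\<close>
  define \<pi> where "\<pi> b = map (\<lambda>j. inv_into X eX j ! ix b) [0..<n]" for b
  have ixl: "ix b < length bs" if "b \<in> pverts B" for b
    using that ix bs(2) by (metis in_set_conv_nth)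
  have \<pi>: "\<pi> b \<in> nlists n V" if "b \<in> pverts B" for b
    using ixl[OF that] bij_betwE[OF bij_betw_inv_into[OF eX]]
    by (auto simp: \<pi>_def nlists_iff_nth X_def)
  have \<pi>X: "\<pi> b ! eX x = x ! ix b" if "x \<in> X" for b x
    using eXn[OF that] bij_betw_inv_into_left[OF eX that] by (simp add: \<pi>_def)
  have "digraph_hom B Q \<pi>"
    unfolding digraph_hom_def
  proof (intro conjI allI impI)
    show "\<pi> ` pverts B \<subseteq> pverts Q" using \<pi> by (auto simp: Q_def)
    fix b c assume bc: "arc B b c"
    then obtain i j where ij: "(i, j) \<in> set es" "b = bs ! i" "c = bs ! j" using es(2) by auto
    then obtain e where e: "e < length es" "es ! e = (i, j)" by (auto simp: in_set_conv_nth)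
    have "ix b = i" "ix c = j" using ij es(1)[OF ij(1)] ix by auto
    then show "arc Q (\<pi> b) (\<pi> c)"
      unfolding arcQ using e \<pi> structure_digraph_arcD[OF B bc]
      by (intro conjI exI[of _ "\<lambda>y. y ! e"])
        (auto simp: wit_def \<pi>X src_def tgt_def Y_def nlists_iff_nth list_all2_conv_all_nth)
  qed
  ultimately have "hom_equivalent B Q" by (auto simp: hom_equivalent_def)
  with power show ?thesis by (auto simp: pp_constructs_def)
qed

section \<open>Pp-constructability as existence of minion homomorphisms\<close>

lemma map_nth_eq_reindex:
  "map (\<lambda>(i, j). xs ! i) es = reindex (length es) (\<lambda>e. fst (es ! e)) xs"
  "map (\<lambda>(i, j). xs ! j) es = reindex (length es) (\<lambda>e. snd (es ! e)) xs"
  by (simp_all add: list_eq_iff_nth_eq case_prod_beta)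

lemma minion_homD:
  assumes "minion_hom A B \<xi>" "k \<ge> 1" "pol A k f"
  shows "pol B k (\<xi> k f)"
    and "pol A m g \<Longrightarrow> \<sigma> ` {..<k} \<subseteq> {..<m} \<Longrightarrow>
      (\<And>xs. xs \<in> nlists m (pverts A) \<Longrightarrow> g xs = f (reindex k \<sigma> xs)) \<Longrightarrow>
      ys \<in> nlists m (pverts B) \<Longrightarrow> \<xi> m g ys = \<xi> k f (reindex k \<sigma> ys)"
  using assms unfolding minion_hom_def by simp_all

lemma minion_homI:
  assumes "\<And>k f. k \<ge> 1 \<Longrightarrow> pol A k f \<Longrightarrow> pol B k (\<xi> k f)"
    and "\<And>k m f g \<sigma> ys. k \<ge> 1 \<Longrightarrow> pol A k f \<Longrightarrow> pol A m g \<Longrightarrow> \<sigma> ` {..<k} \<subseteq> {..<m} \<Longrightarrow>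
      (\<And>xs. xs \<in> nlists m (pverts A) \<Longrightarrow> g xs = f (reindex k \<sigma> xs)) \<Longrightarrow>
      ys \<in> nlists m (pverts B) \<Longrightarrow> \<xi> m g ys = \<xi> k f (reindex k \<sigma> ys)"
  shows "minion_hom A B \<xi>"
  unfolding minion_hom_def
proof (intro conjI allI impI ballI)
  fix k m f g \<sigma> ys
  assume h: "1 \<le> k" "pol A k f" "pol A m g" "\<sigma> ` {..<k} \<subseteq> {..<m}"
    and e: "\<forall>xs\<in>nlists m (pverts A). g xs = f (reindex k \<sigma> xs)" and y: "ys \<in> nlists m (pverts B)"
  show "\<xi> m g ys = \<xi> k f (reindex k \<sigma> ys)"
    by (rule assms(2)[OF h _ y]) (rule e[rule_format])
qed (rule assms(1))

lemma minion_hom_id: "minion_hom A A (\<lambda>k f. f)"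
  by (rule minion_homI)

lemma minion_arity_pos:
  fixes k m :: nat
  assumes "\<sigma> ` {..<k} \<subseteq> {..<m}" "k \<ge> 1" shows "m \<ge> 1"
proof -
  have "\<sigma> 0 \<in> {..<m}" using assms by (intro subsetD[OF assms(1)] imageI) simp
  then show ?thesis by simp
qed

lemma minion_hom_comp:
  assumes 1: "minion_hom A B \<xi>" and 2: "minion_hom B C \<eta>"
  shows "minion_hom A C (\<lambda>k f. \<eta> k (\<xi> k f))"
proof (rule minion_homI)
  fix k f assume "1 \<le> k" "pol A k f"
  then show "pol C k (\<eta> k (\<xi> k f))" using minion_homD(1)[OF 1] minion_homD(1)[OF 2] by simp
next
  fix k m f g \<sigma> ys
  assume h: "1 \<le> k" "pol A k f" "pol A m g" "\<sigma> ` {..<k} \<subseteq> {..<m}"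
    and e: "\<And>xs. xs \<in> nlists m (pverts A) \<Longrightarrow> g xs = f (reindex k \<sigma> xs)" and y: "ys \<in> nlists m (pverts C)"
  have m: "m \<ge> 1" by (rule minion_arity_pos) fact+
  show "\<eta> m (\<xi> m g) ys = \<eta> k (\<xi> k f) (reindex k \<sigma> ys)"
    by (rule minion_homD(2)[OF 2 h(1) minion_homD(1)[OF 1 h(1,2)] minion_homD(1)[OF 1 m h(3)] h(4) _ y])
      (rule minion_homD(2)[OF 1 h(1,2,3,4) e])
qed

section \<open>Direct products\<close>

lemma pol_direct_product:
  assumes "pol B k f" "pol C k g"
  shows "pol (B \<times>\<^sub>d C) k (\<lambda>zs. (f (map fst zs), g (map snd zs)))"
proof (rule polI)
  fix zs assume z: "zs \<in> nlists k (pverts (B \<times>\<^sub>d C))"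
  have l: "length zs = k" and "\<And>i. i < k \<Longrightarrow> zs ! i \<in> pverts B \<times> pverts C"
    using z by (auto simp: nlists_iff_nth direct_product_def)
  then have "map fst zs \<in> nlists k (pverts B)" "map snd zs \<in> nlists k (pverts C)"
    by (simp_all add: nlists_iff_nth mem_Times_iff)
  then show "(f (map fst zs), g (map snd zs)) \<in> pverts (B \<times>\<^sub>d C)"
    using pol_in[OF assms(1)] pol_in[OF assms(2)] by (simp add: direct_product_def)
next
  fix xs ys assume l: "length xs = k" "length ys = k"
    and "\<And>i. i < k \<Longrightarrow> arc (B \<times>\<^sub>d C) (xs ! i) (ys ! i)"
  then have "arc B (fst (xs ! i)) (fst (ys ! i))" "arc C (snd (xs ! i)) (snd (ys ! i))" if "i < k" for i
    using that by (fastforce simp: direct_product_def)+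
  then have "arc B (f (map fst xs)) (f (map fst ys))" "arc C (g (map snd xs)) (g (map snd ys))"
    using l by (auto intro!: pol_arc[OF assms(1)] pol_arc[OF assms(2)])
  then show "arc (B \<times>\<^sub>d C) (f (map fst xs), g (map snd xs)) (f (map fst ys), g (map snd ys))"
    by (simp add: direct_product_def)
qed

text \<open>Pairing places the product above every common lower bound of its factors.\<close>

lemma minion_hom_product:
  assumes 1: "minion_hom A B \<xi>" and 2: "minion_hom A C \<eta>"
  shows "minion_hom A (B \<times>\<^sub>d C) (\<lambda>k f zs. (\<xi> k f (map fst zs), \<eta> k f (map snd zs)))"
proof (rule minion_homI)
  fix k f assume "1 \<le> k" "pol A k f"
  then show "pol (B \<times>\<^sub>d C) k (\<lambda>zs. (\<xi> k f (map fst zs), \<eta> k f (map snd zs)))"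
    by (intro pol_direct_product minion_homD(1)[OF 1] minion_homD(1)[OF 2])
next
  fix k m f g \<sigma> and zs :: "('b \<times> 'c) list"
  assume h: "1 \<le> k" "pol A k f" "pol A m g" "\<sigma> ` {..<k} \<subseteq> {..<m}"
    and e: "\<And>xs. xs \<in> nlists m (pverts A) \<Longrightarrow> g xs = f (reindex k \<sigma> xs)"
    and z: "zs \<in> nlists m (pverts (B \<times>\<^sub>d C))"
  have l: "length zs = m" and "\<And>i. i < m \<Longrightarrow> zs ! i \<in> pverts B \<times> pverts C"
    using z by (auto simp: nlists_iff_nth direct_product_def)
  then have m: "map fst zs \<in> nlists m (pverts B)" "map snd zs \<in> nlists m (pverts C)"
    by (simp_all add: nlists_iff_nth mem_Times_iff)
  have "map fst (reindex k \<sigma> zs) = reindex k \<sigma> (map fst zs)"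
    "map snd (reindex k \<sigma> zs) = reindex k \<sigma> (map snd zs)"
    using h(4) l by (simp_all add: list_eq_iff_nth_eq image_subset_iff)
  then show "(\<xi> m g (map fst zs), \<eta> m g (map snd zs)) =
      (\<xi> k f (map fst (reindex k \<sigma> zs)), \<eta> k f (map snd (reindex k \<sigma> zs)))"
    using minion_homD(2)[OF 1 h e m(1)] minion_homD(2)[OF 2 h e m(2)] by simp
qed

text \<open>Evaluate the images of polymorphisms at the list \<open>bs\<close> of all vertices of
  \<open>B\<close>. The two minors of an arc-ary \<open>h\<close> then go to the values of the
  polymorphism \<open>\<xi> (length es) h\<close> at the lists of all sources and of all targets,
  hence to an arc.\<close>

lemma minion_hom_imp_pp_constructs:
  assumes A: "finite_digraph A" and B: "finite_digraph B" and \<xi>: "minion_hom A B \<xi>"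
  shows "A \<le>\<^sub>p\<^sub>p B"
proof -
  note fB = finite_digraphD[OF B]
  obtain bs where bs: "set bs = pverts B" "distinct bs" using finite_distinct_list[OF fB(2)] by blast
  define E where "E = {(i, j). i < length bs \<and> j < length bs \<and> arc B (bs ! i) (bs ! j)}"
  have "finite E" by (rule finite_subset[of _ "{..<length bs} \<times> {..<length bs}"]) (auto simp: E_def)
  then obtain es where es: "set es = E" using finite_list by blast
  have nb: "length bs \<ge> 1" using fB(3) bs by (cases bs) auto
  have bsn: "bs \<in> nlists (length bs) (pverts B)" using bs(1) by (simp add: nlists_def)
  show ?thesis
  proof (rule pp_constructsI_free[OF A fB(1) bs(2,1), of es "\<lambda>F. \<xi> (length bs) F bs"])
    fix i j assume "(i, j) \<in> set es"
    then show "i < length bs \<and> j < length bs" by (simp add: es E_def)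
  next
    show "parcs B = (\<lambda>(i, j). (bs ! i, bs ! j)) ` set es" (is "_ = ?R")
    proof
      show "?R \<subseteq> parcs B" by (auto simp: es E_def)
      show "parcs B \<subseteq> ?R"
      proof clarify
        fix x y assume xy: "arc B x y"
        then have "x \<in> set bs" "y \<in> set bs" using structure_digraph_arcD[OF fB(1) xy] bs(1) by simp_all
        then obtain i j where "i < length bs" "x = bs ! i" "j < length bs" "y = bs ! j"
          by (metis in_set_conv_nth)
        then show "(x, y) \<in> ?R" using xy by (intro image_eqI[of _ _ "(i, j)"]) (simp_all add: es E_def)
      qed
    qed
  next
    fix F assume "pol A (length bs) F"
    then show "\<xi> (length bs) F bs \<in> pverts B"
      using pol_in[OF minion_homD(1)[OF \<xi> nb]] bsn by blast
  next
    fix h F F'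
    assume ne: "es \<noteq> []" and h: "pol A (length es) h" and F: "pol A (length bs) F" "pol A (length bs) F'"
      and eq: "\<And>x. x \<in> nlists (length bs) (pverts A) \<Longrightarrow> F x = h (map (\<lambda>(i, j). x ! i) es)"
        "\<And>x. x \<in> nlists (length bs) (pverts A) \<Longrightarrow> F' x = h (map (\<lambda>(i, j). x ! j) es)"
    have ne1: "length es \<ge> 1" using ne by (simp add: Suc_leI)
    have esn: "es ! e \<in> E" if "e < length es" for e using that es nth_mem by blast
    then have im: "(\<lambda>e. fst (es ! e)) ` {..<length es} \<subseteq> {..<length bs}"
      "(\<lambda>e. snd (es ! e)) ` {..<length es} \<subseteq> {..<length bs}"
      by (fastforce simp: E_def)+
    have "\<xi> (length bs) F bs = \<xi> (length es) h (reindex (length es) (\<lambda>e. fst (es ! e)) bs)"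
      by (rule minion_homD(2)[OF \<xi> ne1 h F(1) im(1) eq(1)[unfolded map_nth_eq_reindex] bsn])
    moreover have "\<xi> (length bs) F' bs = \<xi> (length es) h (reindex (length es) (\<lambda>e. snd (es ! e)) bs)"
      by (rule minion_homD(2)[OF \<xi> ne1 h F(2) im(2) eq(2)[unfolded map_nth_eq_reindex] bsn])
    moreover have "arc B (bs ! fst (es ! e)) (bs ! snd (es ! e))" if "e < length es" for e
      using esn[OF that] by (auto simp: E_def)
    ultimately show "arc B (\<xi> (length bs) F bs) (\<xi> (length bs) F' bs)"
      by (simp add: pol_arc[OF minion_homD(1)[OF \<xi> ne1 h]])
  qed
qed

lemma pp_constructs_iff_minion_hom:
  assumes "finite_digraph A" "finite_digraph B"
  shows "A \<le>\<^sub>p\<^sub>p B \<longleftrightarrow> (\<exists>\<xi>. minion_hom A B \<xi>)"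
proof
  show "\<exists>\<xi>. minion_hom A B \<xi>" if "A \<le>\<^sub>p\<^sub>p B"
    by (rule pp_constructs_imp_minion_hom[OF finite_digraphD(1) finite_digraphD(1) that]) fact+
  show "A \<le>\<^sub>p\<^sub>p B" if "\<exists>\<xi>. minion_hom A B \<xi>"
    using that by (elim exE) (rule minion_hom_imp_pp_constructs[OF assms])
qed

lemma pp_constructs_refl: "finite_digraph A \<Longrightarrow> A \<le>\<^sub>p\<^sub>p A"
  using pp_constructs_iff_minion_hom minion_hom_id by blast

lemma pp_constructs_trans:
  assumes "finite_digraph A" "finite_digraph B" "finite_digraph C" "A \<le>\<^sub>p\<^sub>p B" "B \<le>\<^sub>p\<^sub>p C"
  shows "A \<le>\<^sub>p\<^sub>p C"
proof -
  obtain \<xi> \<eta> where "minion_hom A B \<xi>" "minion_hom B C \<eta>"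
    using assms(4,5) unfolding pp_constructs_iff_minion_hom[OF assms(1,2)]
      pp_constructs_iff_minion_hom[OF assms(2,3)] by blast
  from minion_hom_comp[OF this] show ?thesis by (rule minion_hom_imp_pp_constructs[OF assms(1,3)])
qed

lemma finite_direct_product:
  assumes "finite_digraph B" "finite_digraph C" shows "finite_digraph (B \<times>\<^sub>d C)"
  using finite_digraphD[OF assms(1)] finite_digraphD[OF assms(2)]
  by (intro finite_digraphI) (auto simp: direct_product_def)

lemma pp_constructs_product:
  assumes "finite_digraph A" "finite_digraph B" "finite_digraph C" "A \<le>\<^sub>p\<^sub>p B" "A \<le>\<^sub>p\<^sub>p C"
  shows "A \<le>\<^sub>p\<^sub>p B \<times>\<^sub>d C"
proof -
  obtain \<xi> \<eta> where "minion_hom A B \<xi>" "minion_hom A C \<eta>"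
    using assms(4,5) unfolding pp_constructs_iff_minion_hom[OF assms(1,2)]
      pp_constructs_iff_minion_hom[OF assms(1,3)] by blast
  from minion_hom_product[OF this] show ?thesis
    by (rule minion_hom_imp_pp_constructs[OF assms(1) finite_direct_product[OF assms(2,3)]])
qed

lemma hom_equivalent_imp_pp_constructs:
  "finite_digraph A \<Longrightarrow> hom_equivalent A B \<Longrightarrow> A \<le>\<^sub>p\<^sub>p B"
  using pp_constructs_cong_right[OF pp_constructs_refl] by blast

section \<open>Cyclic and quasi Maltsev polymorphisms\<close>

definition cyclic_pol :: "'a pair_pre_digraph \<Rightarrow> nat \<Rightarrow> ('a list \<Rightarrow> 'a) \<Rightarrow> bool" where
  "cyclic_pol A r f \<longleftrightarrow> pol A r f \<and> (\<forall>xs\<in>nlists r (pverts A). f (rotate1 xs) = f xs)"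

text \<open>With \<open>f [x, x, x]\<close> in place of \<open>x\<close>, the Maltsev identities
  compare minors of a single operation, so they pass along minion homomorphisms.\<close>

definition quasi_maltsev :: "'a pair_pre_digraph \<Rightarrow> ('a list \<Rightarrow> 'a) \<Rightarrow> bool" where
  "quasi_maltsev A f \<longleftrightarrow> pol A 3 f \<and>
     (\<forall>x\<in>pverts A. \<forall>y\<in>pverts A. f [x, y, y] = f [x, x, x] \<and> f [y, y, x] = f [x, x, x])"

lemma rotate1_eq_reindex: "length xs = n \<Longrightarrow> rotate1 xs = reindex n (\<lambda>i. Suc i mod n) xs"
  by (auto simp: list_eq_iff_nth_eq nth_rotate1)

text \<open>Cyclicity says that \<open>f\<close> equals its own minor along the cyclic shift of
  positions.\<close>

lemma cyclic_pol_mono: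
  assumes A: "finite_digraph A" and B: "finite_digraph B" and le: "A \<le>\<^sub>p\<^sub>p B"
    and f: "cyclic_pol A r f" and r: "r \<ge> 1"
  shows "\<exists>g. cyclic_pol B r g"
proof -
  obtain \<xi> where \<xi>: "minion_hom A B \<xi>" using A B le pp_constructs_iff_minion_hom by blast
  have p: "pol A r f" and eq: "\<And>xs. xs \<in> nlists r (pverts A) \<Longrightarrow> f xs = f (reindex r (\<lambda>i. Suc i mod r) xs)"
    using f rotate1_eq_reindex nlistsE_length unfolding cyclic_pol_def by metis+
  have im: "(\<lambda>i. Suc i mod r) ` {..<r} \<subseteq> {..<r}" using r by auto
  have "cyclic_pol B r (\<xi> r f)"
    unfolding cyclic_pol_def
    using minion_homD(1)[OF \<xi> r p] minion_homD(2)[OF \<xi> r p p im eq] rotate1_eq_reindex nlistsE_length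
    by metis
  then show ?thesis by blast
qed

text \<open>The identities say that the binary operation \<open>g\<close>, which ignores its second
  argument, is the minor of \<open>f\<close> along three different maps. The corresponding minors of
  the image of \<open>f\<close> therefore coincide as well.\<close>

lemma quasi_maltsev_mono:
  assumes A: "finite_digraph A" and B: "finite_digraph B" and le: "A \<le>\<^sub>p\<^sub>p B"
    and f: "quasi_maltsev A f"
  shows "\<exists>g. quasi_maltsev B g"
proof -
  obtain \<xi> where \<xi>: "minion_hom A B \<xi>" using A B le pp_constructs_iff_minion_hom by blast
  have p: "pol A 3 f" using f by (simp add: quasi_maltsev_def)
  define g where "g xs = f (reindex 3 (\<lambda>i. 0) xs)" for xs :: "'a list"
  have re: "reindex 3 \<sigma> xs = [xs ! \<sigma> 0, xs ! \<sigma> 1, xs ! \<sigma> 2]" for \<sigma> and xs :: "'c list"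
    by (simp add: reindex_def numeral_3_eq_3 numeral_2_eq_2)
  have g: "pol A 2 g" unfolding g_def by (rule pol_reindex[OF p]) auto
  have fm: "f [x, y, y] = f [x, x, x]" "f [y, y, x] = f [x, x, x]" if "x \<in> pverts A" "y \<in> pverts A" for x y
    using f that unfolding quasi_maltsev_def by blast+
  have eq: "g xs = f (reindex 3 \<sigma> xs)" if "xs \<in> nlists 2 (pverts A)"
    and "\<sigma> \<in> {\<lambda>i. 0, \<lambda>i. if i = 0 then 0 else 1, \<lambda>i. if i = 2 then 0 else 1}" for xs \<sigma>
    using that fm[of "xs ! 0" "xs ! 1"] nlistsE_nth_in[OF that(1), of 0] nlistsE_nth_in[OF that(1), of 1]
    unfolding g_def re by auto
  have mi: "\<xi> 2 g ys = \<xi> 3 f (reindex 3 \<sigma> ys)" if "ys \<in> nlists 2 (pverts B)"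
    and "\<sigma> \<in> {\<lambda>i. 0, \<lambda>i. if i = 0 then 0 else 1, \<lambda>i. if i = 2 then 0 else 1}" for ys \<sigma>
    by (rule minion_homD(2)[OF \<xi> _ p g]) (use that eq in auto)
  have "quasi_maltsev B (\<xi> 3 f)"
    unfolding quasi_maltsev_def
  proof (intro conjI ballI)
    show "pol B 3 (\<xi> 3 f)" by (rule minion_homD(1)[OF \<xi> _ p]) simp
    fix x y assume "x \<in> pverts B" "y \<in> pverts B"
    then have "[x, y] \<in> nlists 2 (pverts B)" by (simp add: nlists_def)
    note m = mi[OF this]
    show "\<xi> 3 f [x, y, y] = \<xi> 3 f [x, x, x]" "\<xi> 3 f [y, y, x] = \<xi> 3 f [x, x, x]"
      using m[of "\<lambda>i. 0"] m[of "\<lambda>i. if i = 0 then 0 else 1"] m[of "\<lambda>i. if i = 2 then 0 else 1"]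
      by (simp_all add: re)
  qed
  then show ?thesis by blast
qed

section \<open>Cycles and \<open>T3\<close> as pp-powers\<close>

lemma arc_directed_cycle: "arc (directed_cycle n) x y \<longleftrightarrow> x < n \<and> y = Suc x mod n"
  by (auto simp: directed_cycle_def)

lemma pverts_directed_cycle: "pverts (directed_cycle n) = {..<n}"
  by (simp add: directed_cycle_def)

lemma finite_directed_cycle: "n \<ge> 1 \<Longrightarrow> finite_digraph (directed_cycle n)"
  by (intro finite_digraphI) (auto simp: directed_cycle_def lessThan_empty_iff)

lemma arc_T3: "arc T3 x y \<longleftrightarrow> x < y \<and> y \<le> 2"
  by (auto simp: T3_def)

lemma pverts_T3: "pverts T3 = {..2}"
  by (auto simp: T3_def)

lemma finite_T3: "finite_digraph T3"
  by (intro finite_digraphI) (auto simp: T3_def)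

section \<open>Residue colourings and the free digraph of a cycle\<close>

text \<open>A point gets its signed distance, modulo \<open>n\<close>, from a chosen representative
  of its orbit. Two expressions of that distance differ by a period, hence by a multiple of
  \<open>n\<close>.\<close>

lemma permutation_cyclic_coloring:
  fixes S :: "'x \<Rightarrow> 'x"
  assumes inj: "inj_on S X" and SX: "S ` X \<subseteq> X" and n: "n \<ge> 1"
    and per: "\<And>x d. x \<in> X \<Longrightarrow> (S ^^ d) x = x \<Longrightarrow> n dvd d"
  shows "\<exists>c :: 'x \<Rightarrow> nat. \<forall>x\<in>X. c x < n \<and> c (S x) = Suc (c x) mod n"
proof -
  have pow_X: "(S ^^ i) x \<in> X" if "x \<in> X" for x i
    using that SX by (induction i) auto
  have inj_pow: "x = y" if "(S ^^ i) x = (S ^^ i) y" "x \<in> X" "y \<in> X" for x y i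
    using that
  proof (induction i)
    case (Suc i)
    then show ?case using inj_onD[OF inj _ pow_X pow_X] by simp
  qed simp
  have le: "n dvd b - a" if "(S ^^ a) z = (S ^^ b) z" "z \<in> X" "a \<le> b" for a b z
  proof -
    have "(S ^^ a) ((S ^^ (b - a)) z) = (S ^^ b) z"
      using that(3) by (metis comp_apply funpow_add le_add_diff_inverse)
    then have "(S ^^ a) ((S ^^ (b - a)) z) = (S ^^ a) z" using that(1) by simp
    from inj_pow[OF this pow_X[OF that(2)] that(2)] show ?thesis by (rule per[OF that(2)])
  qed
  have diff: "int n dvd int a - int b" if "(S ^^ a) z = (S ^^ b) z" "z \<in> X" for a b z
  proof (cases "a \<le> b")
    case True
    have "int n dvd int (b - a)" using le[OF that True] by simp
    then show ?thesis using True by (simp add: of_nat_diff dvd_diff_commute)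
  next
    case False
    then have "n dvd a - b" "int (a - b) = int a - int b"
      using le[OF that(1)[symmetric] that(2)] by simp_all
    then show ?thesis by (metis int_dvd_int_iff)
  qed
  define conn where "conn x y \<longleftrightarrow> y \<in> X \<and> (\<exists>i j. (S ^^ i) x = (S ^^ j) y)" for x y
  define \<rho> where "\<rho> x = (SOME y. conn x y)" for x
  have "conn (S x) y \<longleftrightarrow> conn x y" for x y
  proof
    assume "conn (S x) y"
    then obtain i j where "y \<in> X" "(S ^^ Suc i) x = (S ^^ j) y"
      by (auto simp: conn_def funpow_swap1)
    then show "conn x y" unfolding conn_def by blast
  next
    assume "conn x y"
    then obtain i j where "y \<in> X" "(S ^^ i) x = (S ^^ j) y" by (auto simp: conn_def)
    moreover have "(S ^^ i) (S x) = S ((S ^^ i) x)" by (simp add: funpow_swap1)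
    ultimately have "y \<in> X" "(S ^^ i) (S x) = (S ^^ Suc j) y" by simp_all
    then show "conn (S x) y" unfolding conn_def by blast
  qed
  then have \<rho>S: "\<rho> (S x) = \<rho> x" for x unfolding \<rho>_def by presburger
  have "conn x (\<rho> x)" if "x \<in> X" for x
    unfolding \<rho>_def by (rule someI[of _ x]) (use that in \<open>auto simp: conn_def\<close>)
  then have "\<forall>x. \<exists>i j. x \<in> X \<longrightarrow> \<rho> x \<in> X \<and> (S ^^ i) x = (S ^^ j) (\<rho> x)"
    unfolding conn_def by blast
  then obtain I J where IJ: "\<And>x. x \<in> X \<Longrightarrow> \<rho> x \<in> X \<and> (S ^^ I x) x = (S ^^ J x) (\<rho> x)"
    by metis
  \<comment> \<open>\<open>(S ^^ I x) x = (S ^^ J x) (\<rho> x)\<close> places \<open>x\<close>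
    exactly \<open>J x - I x\<close> steps after \<open>\<rho> x\<close>.\<close>
  define c where "c x = nat ((int (J x) - int (I x)) mod int n)" for x
  have "c x < n \<and> c (S x) = Suc (c x) mod n" if x: "x \<in> X" for x
  proof
    have Sx: "S x \<in> X" using x SX by blast
    have ci: "int (c x) = (int (J x) - int (I x)) mod int n" for x
      using n by (simp add: c_def)
    have "int (c x) < int n" unfolding ci using n by simp
    then show "c x < n" by simp
    let ?i = "I x" and ?j = "J x" and ?i' = "I (S x)" and ?j' = "J (S x)" and ?z = "\<rho> x"
    have e: "(S ^^ ?i) x = (S ^^ ?j) ?z" "(S ^^ ?i') (S x) = (S ^^ ?j') ?z"
      using IJ[OF x] IJ[OF Sx] \<rho>S by simp_all
    \<comment> \<open>The descriptions of \<open>x\<close> and of \<open>S x\<close> are prolonged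
      to a common iterate of \<open>x\<close>; the two resulting exponents at the representative
      agree modulo \<open>n\<close>.\<close>
    have "(S ^^ (Suc ?i' + ?j)) ?z = (S ^^ Suc ?i') ((S ^^ ?i) x)" by (simp only: funpow_add comp_apply e)
    also have "\<dots> = (S ^^ (?i + Suc ?i')) x" by (simp only: add.commute[of ?i] funpow_add comp_apply)
    also have "\<dots> = (S ^^ ?i) ((S ^^ ?i') (S x))" by (simp add: funpow_add funpow_swap1)
    also have "\<dots> = (S ^^ (?i + ?j')) ?z" by (simp only: funpow_add comp_apply e)
    finally have "int n dvd int (Suc ?i' + ?j) - int (?i + ?j')" using diff IJ[OF x] by blast
    then have "int n dvd (int ?j - int ?i + 1) - (int ?j' - int ?i')" by (simp add: algebra_simps)
    then have "(int ?j' - int ?i') mod int n = (int ?j - int ?i + 1) mod int n"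
      by (simp add: mod_eq_dvd_iff[symmetric])
    also have "\<dots> = int (Suc (c x) mod n)" by (simp add: of_nat_mod ci mod_simps add.commute)
    finally show "c (S x) = Suc (c x) mod n" using ci[of "S x"] by simp
  qed
  then show ?thesis by blast
qed

text \<open>For a prime \<open>r\<close> dividing \<open>t\<close>, \<open>F\<close> is invariant
  under rotation by \<open>m = n / r\<close>, a multiple of \<open>e\<close>. Substituting one
  variable for each of the \<open>r\<close> blocks of \<open>m\<close> consecutive arguments turns
  this rotation into a cyclic shift.\<close>

lemma cyclic_pol_of_period:
  assumes A: "finite_digraph A" and F: "pol A n F" and n: "n = e * t" "n \<ge> 1" and t: "t > 1"
    and inv: "\<And>z. z \<in> nlists n (pverts A) \<Longrightarrow> F (rotate e z) = F z"
  shows "\<exists>r f. prime r \<and> r dvd n \<and> cyclic_pol A r f"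
proof -
  obtain r where r: "prime r" "r dvd t" using prime_factor_nat[of t] t by auto
  then obtain t' where t': "t = r * t'" by blast
  define m where "m = e * t'"
  have nm: "n = m * r" "m > 0" using n t' by (auto simp: m_def)
  have rot: "rotate k z \<in> nlists n (pverts A)" if "z \<in> nlists n (pverts A)" for z k
    using that by (simp add: nlists_def)
  have "F (rotate (e * k) z) = F z" if "z \<in> nlists n (pverts A)" for z k
  proof (induction k)
    case (Suc k)
    have "F (rotate (e * Suc k) z) = F (rotate e (rotate (e * k) z))" by (simp add: rotate_rotate)
    also have "\<dots> = F z" using inv[OF rot[OF that]] Suc by simp
    finally show ?case .
  qed simp
  then have invm: "F (rotate m z) = F z" if "z \<in> nlists n (pverts A)" for z
    using that unfolding m_def .
  let ?\<sigma> = "\<lambda>i. i div m"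
  have im: "?\<sigma> ` {..<n} \<subseteq> {..<r}" using nm by (auto simp: less_mult_imp_div_less mult.commute)
  have "cyclic_pol A r (\<lambda>y. F (reindex n ?\<sigma> y))"
    unfolding cyclic_pol_def
  proof (intro conjI ballI)
    show "pol A r (\<lambda>y. F (reindex n ?\<sigma> y))" by (rule pol_reindex[OF F im])
    fix y assume y: "y \<in> nlists r (pverts A)"
    have "reindex n ?\<sigma> (rotate1 y) = rotate m (reindex n ?\<sigma> y)"
    proof (rule nth_equalityI)
      fix i assume "i < length (reindex n ?\<sigma> (rotate1 y))"
      then have i: "i < n" by simp
      have "i div m < r" using im i by auto
      then have "reindex n ?\<sigma> (rotate1 y) ! i = y ! (Suc (i div m) mod r)"
        using i nlistsE_length[OF y] by (simp add: nth_rotate1)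
      moreover have "((m + i) mod n) div m = (m + i) div m mod r"
        unfolding nm(1) mod_mult2_eq using nm(2) by simp
      moreover have "(m + i) mod n < n" using n(2) by simp
      ultimately show "reindex n ?\<sigma> (rotate1 y) ! i = rotate m (reindex n ?\<sigma> y) ! i"
        using i nm(2) by (simp add: nth_rotate)
    qed simp
    then show "F (reindex n ?\<sigma> (rotate1 y)) = F (reindex n ?\<sigma> y)"
      using invm[OF reindex_nlists[OF y im]] by simp
  qed
  then show ?thesis using r nm(1) by auto
qed

text \<open>The arcs of the free digraph lead from an \<open>n\<close>-ary polymorphism to its
  rotation, so they form a permutation, which is coloured by residues. A period not divisible by
  \<open>n\<close> would yield a cyclic polymorphism of prime arity dividing
  \<open>n\<close>.\<close>

lemma pp_constructs_directed_cycle: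
  assumes A: "finite_digraph A" and n: "n \<ge> 1"
    and no: "\<And>r f. prime r \<Longrightarrow> r dvd n \<Longrightarrow> \<not> cyclic_pol A r f"
  shows "A \<le>\<^sub>p\<^sub>p directed_cycle n"
proof -
  note fA = finite_digraphD[OF A]
  define N where "N = nlists n (pverts A)"
  \<comment> \<open>Fixing the values off \<open>N\<close> removes junk, so that rotation becomes
    injective.\<close>
  define X where "X = {F. pol A n F \<and> F \<in> extensional N}"
  define S where "S F = restrict (\<lambda>x. F (rotate1 x)) N" for F :: "'a list \<Rightarrow> 'a"
  have rotN: "rotate k z \<in> N" if "z \<in> N" for z k using that by (simp add: N_def nlists_def)
  have rot1N: "rotate1 z \<in> N" if "z \<in> N" for z using that by (simp add: N_def nlists_def)
  have im: "(\<lambda>i. Suc i mod n) ` {..<n} \<subseteq> {..<n}" using n by auto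
  have polr: "pol A n (\<lambda>x. F (rotate1 x))" if "pol A n F" for F
    by (rule pol_cong[OF fA(1) pol_reindex[OF that im]]) (simp add: rotate1_eq_reindex nlistsE_length)
  have restr: "pol A n (restrict F N)" if "pol A n F" for F
    by (rule pol_cong[OF fA(1) that]) (simp add: N_def)
  have SX: "S ` X \<subseteq> X" using polr restr by (auto simp: X_def S_def)
  have inj: "inj_on S X"
  proof (rule inj_onI)
    fix F G assume F: "F \<in> X" and G: "G \<in> X" and eq: "S F = S G"
    show "F = G"
    proof (rule extensionalityI[of _ N])
      fix z assume z: "z \<in> N"
      have "rotate1 (rotate (n - 1) z) = rotate n z" using n by (cases n) simp_all
      also have "\<dots> = z" using z by (simp add: N_def nlistsE_length)
      finally show "F z = G z" using fun_cong[OF eq, of "rotate (n - 1) z"] rotN[OF z] by (simp add: S_def)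
    qed (use F G in \<open>auto simp: X_def\<close>)
  qed
  have pow: "(S ^^ d) F z = F (rotate d z)" if "z \<in> N" for F d z
    using that
  proof (induction d arbitrary: z)
    case (Suc d)
    have "(S ^^ Suc d) F z = (S ^^ d) F (rotate1 z)" using Suc.prems by (simp add: S_def)
    also have "\<dots> = F (rotate (Suc d) z)" using Suc.IH[OF rot1N[OF Suc.prems]] by (simp add: rotate1_rotate_swap)
    finally show ?case .
  qed simp
  have per: "n dvd d" if F: "F \<in> X" and d: "(S ^^ d) F = F" for F d
  proof (rule ccontr)
    assume nd: "\<not> n dvd d"
    then have "d \<noteq> 0" by (metis dvd_0_right)
    \<comment> \<open>Invariance under rotation by \<open>d\<close> gives invariance under rotation
      by \<open>gcd d n\<close>, a proper divisor of \<open>n\<close>, because rotation by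
      \<open>n\<close> is trivial.\<close>
    then obtain x y where xy: "d * x = n * y + gcd d n" using bezout_nat by blast
    have mult: "F (rotate (d * k) z) = F z" if "z \<in> N" for k z
    proof (induction k)
      case (Suc k)
      have "F (rotate (d * Suc k) z) = F (rotate d (rotate (d * k) z))" by (simp add: rotate_rotate)
      also have "\<dots> = F z" using pow[OF rotN[OF that], of d F] d Suc by simp
      finally show ?case .
    qed simp
    have inv: "F (rotate (gcd d n) z) = F z" if "z \<in> N" for z
    proof -
      have "rotate (d * x) z = rotate (gcd d n) z"
        using that rotate_conv_mod[of "n * y + gcd d n" z] rotate_conv_mod[of "gcd d n" z]
        by (simp add: xy N_def nlistsE_length)
      then show ?thesis using mult[OF that] by metis
    qed
    obtain t where t: "n = gcd d n * t" by (meson dvdE gcd_dvd2)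
    have "t \<noteq> 1" using t nd by (metis gcd_dvd1 mult.right_neutral)
    moreover have "t \<noteq> 0" using t n by (metis mult_0_right not_one_le_zero)
    ultimately have "t > 1" by simp
    then have "\<exists>r f. prime r \<and> r dvd n \<and> cyclic_pol A r f"
      using F inv[unfolded N_def] by (intro cyclic_pol_of_period[OF A _ t n, where F = F]) (simp_all add: X_def)
    then show False using no by blast
  qed
  obtain c :: "('a list \<Rightarrow> 'a) \<Rightarrow> nat" where c: "\<And>F. F \<in> X \<Longrightarrow> c F < n" "\<And>F. F \<in> X \<Longrightarrow> c (S F) = Suc (c F) mod n"
    using permutation_cyclic_coloring[OF inj SX n] per by blast
  let ?es = "map (\<lambda>i. (i, Suc i mod n)) [0..<n]"
  show ?thesis
  proof (rule pp_constructsI_free[OF A finite_digraphD(1)[OF finite_directed_cycle[OF n]],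
        of "[0..<n]" ?es "\<lambda>F. c (restrict F N)"])
    show "parcs (directed_cycle n) = (\<lambda>(i, j). ([0..<n] ! i, [0..<n] ! j)) ` set ?es" (is "?L = ?R")
    proof -
      have "?R = (\<lambda>i. (i, Suc i mod n)) ` {0..<n}"
        unfolding set_map image_image set_upt using n by (intro image_cong) auto
      then show ?thesis by (auto simp: directed_cycle_def)
    qed
  next
    fix F assume "pol A (length [0..<n]) F"
    then show "c (restrict F N) \<in> pverts (directed_cycle n)"
      using restr c(1) by (simp add: pverts_directed_cycle X_def)
  next
    fix h F F'
    assume F: "pol A (length [0..<n]) F" "pol A (length [0..<n]) F'"
      and eq: "\<And>x. x \<in> nlists (length [0..<n]) (pverts A) \<Longrightarrow> F x = h (map (\<lambda>(i, j). x ! i) ?es)"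
        "\<And>x. x \<in> nlists (length [0..<n]) (pverts A) \<Longrightarrow> F' x = h (map (\<lambda>(i, j). x ! j) ?es)"
    have "F x = h x" "F' x = h (rotate1 x)" if "x \<in> N" for x
    proof -
      have l: "length x = n" using that by (simp add: N_def nlistsE_length)
      then have "map (\<lambda>(i, j). x ! i) ?es = x" "map (\<lambda>(i, j). x ! j) ?es = rotate1 x"
        by (simp_all add: list_eq_iff_nth_eq nth_rotate1)
      then show "F x = h x" "F' x = h (rotate1 x)" using eq that by (simp_all add: N_def)
    qed
    then have "restrict F' N = S (restrict F N)"
      using rot1N by (auto simp: S_def restrict_def fun_eq_iff)
    then show "arc (directed_cycle n) (c (restrict F N)) (c (restrict F' N))"
      using c restr F by (simp add: arc_directed_cycle X_def)
  qed (auto simp: pverts_directed_cycle lessThan_atLeast0)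
qed

section \<open>The free digraph of \<open>T3\<close>\<close>

text \<open>A polymorphism is sent to the length, capped at 2, of a longest walk of the free digraph
  ending in it. This is a homomorphism when there is no walk of length 3.\<close>

lemma pp_constructs_T3:
  assumes A: "finite_digraph A" and no: "\<And>f. \<not> quasi_maltsev A f"
  shows "A \<le>\<^sub>p\<^sub>p T3"
proof -
  define N where "N = nlists 3 (pverts A)"
  \<comment> \<open>With the arcs listed as (0,1), (0,2), (1,2), the sources are 0, 0, 1 and the
    targets 1, 2, 2.\<close>
  define D where "D F F' \<longleftrightarrow> (\<exists>h. pol A 3 h \<and> (\<forall>x\<in>N. F x = h [x ! 0, x ! 0, x ! 1]) \<and>
    (\<forall>x\<in>N. F' x = h [x ! 1, x ! 2, x ! 2]))" for F F' :: "'a list \<Rightarrow> 'a"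
  have chain: False if D: "D F0 F1" "D F1 F2" "D F2 F3" for F0 F1 F2 F3
  proof -
    obtain h0 where h0: "\<And>x. x \<in> N \<Longrightarrow> F1 x = h0 [x ! 1, x ! 2, x ! 2]" using D(1) by (auto simp: D_def)
    obtain h1 where h1: "pol A 3 h1" "\<And>x. x \<in> N \<Longrightarrow> F1 x = h1 [x ! 0, x ! 0, x ! 1]"
      "\<And>x. x \<in> N \<Longrightarrow> F2 x = h1 [x ! 1, x ! 2, x ! 2]" using D(2) by (auto simp: D_def)
    obtain h2 where h2: "\<And>x. x \<in> N \<Longrightarrow> F2 x = h2 [x ! 0, x ! 0, x ! 1]" using D(3) by (auto simp: D_def)
    \<comment> \<open>The source minor of \<open>h1\<close> is a target minor of \<open>h0\<close>,
      so it does not depend on variable 0; its target minor is a source minor of \<open>h2\<close>,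
      so it does not depend on variable 2. These are the two identities.\<close>
    have e1: "h1 [x, x, y] = h0 [y, z, z]" and e2: "h1 [y, z, z] = h2 [x, x, y]"
      if "x \<in> pverts A" "y \<in> pverts A" "z \<in> pverts A" for x y z
    proof -
      have "[x, y, z] \<in> N" using that by (simp add: N_def nlists_def)
      from h0[OF this] h1(2,3)[OF this] h2[OF this]
      show "h1 [x, x, y] = h0 [y, z, z]" "h1 [y, z, z] = h2 [x, x, y]" by simp_all
    qed
    have "quasi_maltsev A h1"
      unfolding quasi_maltsev_def
    proof (intro conjI ballI)
      fix x y assume xy: "x \<in> pverts A" "y \<in> pverts A"
      show "h1 [x, y, y] = h1 [x, x, x]" using e2[OF xy(1) xy(1,2)] e2[OF xy(1,1,1)] by simp
      show "h1 [y, y, x] = h1 [x, x, x]" using e1[OF xy(2,1,1)] e1[OF xy(1,1,1)] by simp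
    qed (rule h1)
    then show False using no by blast
  qed
  define g :: "('a list \<Rightarrow> 'a) \<Rightarrow> nat" where
    "g F = (if \<exists>F1 F2. D F2 F1 \<and> D F1 F then 2 else if \<exists>F1. D F1 F then 1 else 0)" for F
  show ?thesis
  proof (rule pp_constructsI_free[OF A finite_digraphD(1)[OF finite_T3], of "[0, 1, 2]" "[(0, 1), (0, 2), (1, 2)]" g])
    show "parcs T3 = (\<lambda>(i, j). ([0, 1, 2] ! i, [0, 1, 2] ! j)) ` set [(0, 1), (0, 2), (1, 2)]"
      by (simp add: T3_def)
  next
    fix h F F'
    assume h: "pol A (length [(0, 1), (0, 2), (1, 2)]) h"
      and eq: "\<And>x. x \<in> nlists (length [0, 1, 2]) (pverts A) \<Longrightarrow> F x = h (map (\<lambda>(i, j). x ! i) [(0, 1), (0, 2), (1, 2)])"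
        "\<And>x. x \<in> nlists (length [0, 1, 2]) (pverts A) \<Longrightarrow> F' x = h (map (\<lambda>(i, j). x ! j) [(0, 1), (0, 2), (1, 2)])"
    have "D F F'" unfolding D_def N_def using h eq by (intro exI[of _ h]) (simp add: numeral_3_eq_3)
    then show "arc T3 (g F) (g F')" unfolding arc_T3 g_def using chain by auto
  qed (auto simp: pverts_T3 g_def)
qed

section \<open>Polymorphisms of cycles and of \<open>T3\<close> times a cycle\<close>

text \<open>Infinite sequences with a period \<open>n\<close>, not necessarily the least one, make
  shifts of a walk easy to express.\<close>

definition closed_walk :: "'a rel \<Rightarrow> nat \<Rightarrow> (nat \<Rightarrow> 'a) \<Rightarrow> bool" where
  "closed_walk E n w \<longleftrightarrow> (\<forall>i. (w i, w (Suc i)) \<in> E) \<and> (\<forall>i. w (i + n) = w i)"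

text \<open>Apply \<open>f\<close> to the \<open>r\<close> copies of the walk shifted by multiples
  of \<open>m\<close>. A further shift by \<open>m\<close> only rotates the arguments, so the
  resulting walk has period \<open>m\<close>.\<close>

lemma closed_walk_cyclic_pol:
  assumes A: "structure_digraph A" and f: "cyclic_pol A r f" and r: "r \<ge> 1"
    and w: "closed_walk (parcs A) (r * m) w"
  shows "\<exists>u. closed_walk (parcs A) m u"
proof -
  define u where "u i = f (map (\<lambda>j. w (i + j * m)) [0..<r])" for i
  have p: "pol A r f" using f by (simp add: cyclic_pol_def)
  have arc: "arc A (w i) (w (Suc i))" for i using w by (simp add: closed_walk_def)
  have per: "w (i + r * m) = w i" for i using w by (simp add: closed_walk_def)
  have "arc A (u i) (u (Suc i))" for i
    unfolding u_def by (rule pol_arc[OF p]) (use arc in simp_all)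
  moreover have "u (i + m) = u i" for i
  proof -
    let ?xs = "map (\<lambda>j. w (i + j * m)) [0..<r]"
    have "?xs \<in> nlists r (pverts A)"
      using structure_digraph_arcD(1)[OF A arc] by (simp add: nlists_iff_nth)
    then have "f (rotate1 ?xs) = f ?xs" using f by (simp add: cyclic_pol_def)
    moreover have "rotate1 ?xs = map (\<lambda>j. w (i + m + j * m)) [0..<r]"
    proof (rule nth_equalityI)
      fix j assume "j < length (rotate1 ?xs)"
      then have j: "j < r" by simp
      show "rotate1 ?xs ! j = map (\<lambda>j. w (i + m + j * m)) [0..<r] ! j"
      proof (cases "Suc j = r")
        case True
        then have "w (i + m + j * m) = w (i + r * m)" by (auto simp: algebra_simps)
        then show ?thesis using True j per by (simp add: nth_rotate1)
      next
        case False
        then show ?thesis using j by (simp add: nth_rotate1 algebra_simps)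
      qed
    qed simp
    ultimately show ?thesis by (simp add: u_def)
  qed
  ultimately show ?thesis unfolding closed_walk_def by blast
qed

lemma closed_walk_directed_cycle: "n \<ge> 1 \<Longrightarrow> closed_walk (parcs (directed_cycle n)) n (\<lambda>i. i mod n)"
  by (simp add: closed_walk_def arc_directed_cycle mod_Suc_eq)

lemma closed_walk_directed_cycle_dvd:
  assumes "closed_walk (parcs (directed_cycle n)) m w"
  shows "n dvd m"
proof -
  have arc: "w i < n" "w (Suc i) = Suc (w i) mod n" for i
    using assms by (simp_all add: closed_walk_def arc_directed_cycle)
  have "w i = (w 0 + i) mod n" for i
    by (induction i) (use arc in \<open>simp_all add: mod_Suc_eq\<close>)
  then have "(w 0 + m) mod n = w 0 mod n"
    using assms arc(1)[of 0] by (metis add_0 closed_walk_def mod_less)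
  then show ?thesis by (metis add_diff_cancel_left' le_add1 mod_eq_dvd_iff_nat)
qed

text \<open>Such a polymorphism would shorten the walk once around the cycle to a closed walk of
  length \<open>n / r\<close>.\<close>

lemma no_cyclic_pol_directed_cycle:
  assumes "n \<ge> 1" "r dvd n" "r > 1"
  shows "\<not> cyclic_pol (directed_cycle n) r f"
proof
  assume f: "cyclic_pol (directed_cycle n) r f"
  obtain m where m: "n = r * m" using assms(2) by blast
  obtain u where "closed_walk (parcs (directed_cycle n)) m u"
    using closed_walk_cyclic_pol[OF finite_digraphD(1)[OF finite_directed_cycle[OF assms(1)]] f]
      closed_walk_directed_cycle[OF assms(1)] assms(3) m by auto
  then have "n dvd m" by (rule closed_walk_directed_cycle_dvd)
  then show False using m assms by (auto dest!: dvd_imp_le)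
qed

section \<open>Operations on cycles and on \<open>T3\<close> times a cycle\<close>

text \<open>Averages exist modulo \<open>n\<close> because \<open>r\<close> is invertible: adding 1
  to all arguments adds \<open>r\<close> to their sum and 1 to the average.\<close>

lemma cyclic_pol_directed_cycle:
  assumes n: "n \<ge> 1" and r: "coprime r n"
  shows "\<exists>f. cyclic_pol (directed_cycle n) r f"
proof -
  obtain k where k: "[r * k = 1] (mod n)" using cong_solve_coprime_nat[OF r] by auto
  define f where "f xs = (k * sum_list xs) mod n" for xs
  have "cyclic_pol (directed_cycle n) r f"
    unfolding cyclic_pol_def
  proof (intro conjI ballI polI)
    show "f xs \<in> pverts (directed_cycle n)" for xs using n by (simp add: f_def pverts_directed_cycle)
    show "f (rotate1 xs) = f xs" for xs by (cases xs) (simp_all add: f_def add.commute)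
    fix xs ys :: "nat list" assume l: "length xs = r" "length ys = r"
      and a: "\<And>i. i < r \<Longrightarrow> arc (directed_cycle n) (xs ! i) (ys ! i)"
    have "[sum_list ys = (\<Sum>i<r. xs ! i + 1)] (mod n)"
      unfolding sum_list_sum_nth l lessThan_atLeast0 using a
      by (intro cong_sum) (auto simp: arc_directed_cycle cong_def)
    also have "(\<Sum>i<r. xs ! i + 1) = sum_list xs + r"
      by (simp add: sum_Suc sum_list_sum_nth l lessThan_atLeast0)
    finally have "[k * sum_list ys = k * (sum_list xs + r)] (mod n)" by (rule cong_scalar_left)
    also have "k * (sum_list xs + r) = k * sum_list xs + r * k" by (simp add: algebra_simps)
    also have "[\<dots> = k * sum_list xs + 1] (mod n)" by (intro cong_add k cong_refl)
    finally have "f ys = Suc (f xs) mod n" by (simp add: f_def cong_def mod_Suc_eq)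
    then show "arc (directed_cycle n) (f xs) (f ys)" using n by (simp add: arc_directed_cycle f_def)
  qed
  then show ?thesis by blast
qed

text \<open>The operation x - y + z modulo \<open>n\<close> works; it is computed in the integers
  for the sake of the subtraction.\<close>

lemma quasi_maltsev_directed_cycle:
  assumes n: "n \<ge> 1"
  shows "\<exists>f. quasi_maltsev (directed_cycle n) f"
proof -
  define f where "f xs = nat ((int (xs ! 0) - int (xs ! 1) + int (xs ! 2)) mod int n)" for xs
  have fi: "int (f xs) = (int (xs ! 0) - int (xs ! 1) + int (xs ! 2)) mod int n" for xs
    using n by (simp add: f_def)
  have lt: "f xs < n" for xs
  proof -
    have "int (f xs) < int n" unfolding fi using n by simp
    then show ?thesis by simp
  qed
  have "quasi_maltsev (directed_cycle n) f"
    unfolding quasi_maltsev_def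
  proof (intro conjI ballI polI)
    show "f xs \<in> pverts (directed_cycle n)" for xs using lt by (simp add: pverts_directed_cycle)
    fix xs ys :: "nat list" assume l: "length xs = 3" "length ys = 3"
      and a: "\<And>i. i < 3 \<Longrightarrow> arc (directed_cycle n) (xs ! i) (ys ! i)"
    have y: "int (ys ! i) = (int (xs ! i) + 1) mod int n" if "i < 3" for i
      using a[OF that] by (simp add: arc_directed_cycle of_nat_mod add.commute)
    have "int (f ys) = int (Suc (f xs) mod n)"
    proof -
      let ?a = "int (xs ! 0)" and ?b = "int (xs ! 1)" and ?c = "int (xs ! 2)"
      have "int (f ys) = ((?a + 1) mod int n - (?b + 1) mod int n + (?c + 1) mod int n) mod int n"
        using y[of 0] y[of 1] y[of 2] by (simp only: fi)
      also have "\<dots> = ((?a + 1) - (?b + 1) + (?c + 1)) mod int n"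
        by (intro mod_add_cong mod_diff_cong) simp_all
      also have "\<dots> = (?a - ?b + ?c + 1) mod int n" by (simp add: algebra_simps)
      also have "\<dots> = ((?a - ?b + ?c) mod int n + 1) mod int n" by (simp only: mod_add_left_eq)
      also have "\<dots> = int (Suc (f xs) mod n)" by (simp add: of_nat_mod fi add.commute)
      finally show ?thesis .
    qed
    then show "arc (directed_cycle n) (f xs) (f ys)" using lt by (simp add: arc_directed_cycle)
  qed (simp_all add: f_def)
  then show ?thesis by blast
qed

text \<open>When every argument moves along an arc, the maximum increases strictly.\<close>

lemma cyclic_pol_T3: "r \<ge> 1 \<Longrightarrow> cyclic_pol T3 r (\<lambda>xs. Max (set xs))"
  unfolding cyclic_pol_def
proof (intro conjI ballI polI)
  fix xs :: "nat list" assume r: "r \<ge> 1"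
  {
    assume x: "xs \<in> nlists r (pverts T3)"
    then have "xs \<noteq> []" "set xs \<subseteq> pverts T3" using r by (auto simp: nlists_def)
    then show "Max (set xs) \<in> pverts T3" using Max_in[of "set xs"] by auto
    show "Max (set (rotate1 xs)) = Max (set xs)" by simp
  }
  fix ys :: "nat list"
  assume l: "length xs = r" "length ys = r" and a: "\<And>i. i < r \<Longrightarrow> arc T3 (xs ! i) (ys ! i)"
  have ne: "xs \<noteq> []" "ys \<noteq> []" using l r by auto
  have "Max (set xs) \<in> set xs" "Max (set ys) \<in> set ys" using ne by simp_all
  then obtain i j where i: "i < r" "Max (set xs) = xs ! i" and j: "j < r" "Max (set ys) = ys ! j"
    using l by (metis in_set_conv_nth)
  have "Max (set xs) < ys ! i" using a[OF i(1)] i(2) by (simp add: arc_T3)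
  also have "\<dots> \<le> Max (set ys)" using i(1) l by simp
  finally show "arc T3 (Max (set xs)) (Max (set ys))" using a[OF j(1)] j(2) by (simp add: arc_T3)
qed

lemma cyclic_pol_product:
  assumes "cyclic_pol B r f" "cyclic_pol C r g"
  shows "cyclic_pol (B \<times>\<^sub>d C) r (\<lambda>zs. (f (map fst zs), g (map snd zs)))"
  unfolding cyclic_pol_def
proof (intro conjI ballI)
  show "pol (B \<times>\<^sub>d C) r (\<lambda>zs. (f (map fst zs), g (map snd zs)))"
    using assms by (intro pol_direct_product) (simp_all add: cyclic_pol_def)
  fix zs assume "zs \<in> nlists r (pverts (B \<times>\<^sub>d C))"
  then have "map fst zs \<in> nlists r (pverts B)" "map snd zs \<in> nlists r (pverts C)"
    by (auto simp: nlists_def direct_product_def)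
  then show "(f (map fst (rotate1 zs)), g (map snd (rotate1 zs))) = (f (map fst zs), g (map snd zs))"
    using assms by (simp add: cyclic_pol_def rotate1_map[symmetric])
qed

lemma arc_T3_cycle: "arc (T3 \<times>\<^sub>d directed_cycle n) (x, i) (y, j) \<longleftrightarrow> x < y \<and> y \<le> 2 \<and> i < n \<and> j = Suc i mod n"
  by (auto simp: direct_product_def arc_T3 arc_directed_cycle)

text \<open>Consider rows of points on one level that run once around the cycle. Cyclicity
  identifies the values of \<open>f\<close> on the row of level 1 and on its shift, so the values on
  levels 0, 1 and 2 form a transitive triangle. Its projection to the cycle would contain a
  loop.\<close>

lemma no_cyclic_pol_T3_cycle:
  assumes n: "n > 1"
  shows "\<not> cyclic_pol (T3 \<times>\<^sub>d directed_cycle n) n f"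
proof
  let ?P = "T3 \<times>\<^sub>d directed_cycle n"
  assume f: "cyclic_pol ?P n f"
  define row where "row x k = map (\<lambda>j. (x, (j + k) mod n)) [0..<n]" for x k :: nat
  have arcs: "arc ?P (f (row x k)) (f (row y (Suc k)))" if "x < y" "y \<le> 2" for x y k
  proof (rule pol_arc)
    show "pol ?P n f" using f by (simp add: cyclic_pol_def)
  qed (use that n in \<open>simp_all add: row_def arc_T3_cycle mod_Suc_eq\<close>)
  have "row (Suc 0) 0 \<in> nlists n (pverts ?P)"
    using n by (simp add: row_def nlists_iff_nth direct_product_def pverts_T3 pverts_directed_cycle)
  then have "f (rotate1 (row (Suc 0) 0)) = f (row (Suc 0) 0)" using f by (simp add: cyclic_pol_def)
  moreover have "rotate1 (row (Suc 0) 0) = row (Suc 0) (Suc 0)"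
    using n by (simp add: row_def list_eq_iff_nth_eq nth_rotate1)
  ultimately have rot: "f (row (Suc 0) (Suc 0)) = f (row (Suc 0) 0)" by simp
  obtain x i where a: "f (row (Suc 0) 0) = (x, i)" by force
  obtain y j where b: "f (row 2 (Suc 0)) = (y, j)" by force
  obtain z k where c: "f (row 0 0) = (z, k)" by force
  have "arc ?P (x, i) (y, j)" using arcs[of "Suc 0" 2 0] by (simp add: a b)
  moreover have "arc ?P (z, k) (y, j)" using arcs[of 0 2 0] by (simp add: b c)
  moreover have "arc ?P (z, k) (x, i)" using arcs[of 0 "Suc 0" 0] rot by (simp add: a c)
  ultimately have "i < n" "Suc i mod n = i" by (simp_all add: arc_T3_cycle)
  then show False using n by (metis Suc_lessI mod_less mod_self n_not_Suc_n less_numeral_extra(4) One_nat_def)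
qed

text \<open>The arcs 1 -> 2, 0 -> 2, 0 -> 1 in the first coordinate give, by the identities, an arc
  from the value at a constant triple of level 1 to the value one position further. Once around the
  cycle, the first coordinate would exceed itself.\<close>

lemma no_quasi_maltsev_T3_cycle:
  assumes n: "n \<ge> 1"
  shows "\<not> quasi_maltsev (T3 \<times>\<^sub>d directed_cycle n) f"
proof
  let ?P = "T3 \<times>\<^sub>d directed_cycle n"
  assume f: "quasi_maltsev ?P f"
  define d where "d k = f [(1, k mod n), (1, k mod n), (1, k mod n)]" for k
  have V: "(x, k mod n) \<in> pverts ?P" if "x \<le> 2" for x k
    using n that by (simp add: direct_product_def pverts_T3 pverts_directed_cycle)
  have p: "pol ?P 3 f" and eq: "\<And>x y. x \<in> pverts ?P \<Longrightarrow> y \<in> pverts ?P \<Longrightarrow> f [x, y, y] = f [x, x, x] \<and> f [y, y, x] = f [x, x, x]"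
    using f unfolding quasi_maltsev_def by blast+
  have "arc ?P (d k) (d (Suc k))" for k
  proof -
    have "arc ?P (f [(1, k mod n), (0, k mod n), (0, k mod n)])
        (f [(2, Suc k mod n), (2, Suc k mod n), (1, Suc k mod n)])"
      using n by (intro pol_arc[OF p]) (auto simp: arc_T3_cycle mod_Suc_eq less_Suc_eq numeral_3_eq_3)
    then show ?thesis using eq[OF V V, of 1 0 k k] eq[OF V V, of 1 2 "Suc k" "Suc k"] by (simp add: d_def)
  qed
  then have "fst (d k) < fst (d (Suc k))" for k
    by (metis arc_T3_cycle prod.collapse)
  then have "strict_mono (\<lambda>k. fst (d k))" by (rule strict_mono_Suc_iff[THEN iffD2, rule_format])
  then have "fst (d 0) < fst (d n)" using n by (simp add: strict_mono_def)
  then show False by (simp add: d_def)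
qed

section \<open>Totally rectangular relations\<close>

definition totally_rectangular :: "'a rel \<Rightarrow> bool" where
  "totally_rectangular E \<longleftrightarrow>
    (\<forall>k a b c d. (a, c) \<in> E ^^ k \<longrightarrow> (b, c) \<in> E ^^ k \<longrightarrow> (b, d) \<in> E ^^ k \<longrightarrow> (a, d) \<in> E ^^ k)"

lemma totally_rectangularD:
  "totally_rectangular E \<Longrightarrow> (a, c) \<in> E ^^ k \<Longrightarrow> (b, c) \<in> E ^^ k \<Longrightarrow> (b, d) \<in> E ^^ k \<Longrightarrow> (a, d) \<in> E ^^ k"
  unfolding totally_rectangular_def by blast

lemma totally_rectangular_Image_eq:
  assumes "totally_rectangular E" "(a, c) \<in> E" "(b, c) \<in> E"
  shows "E `` {a} = E `` {b}"
  using totally_rectangularD[OF assms(1), of _ _ 1] assms(2,3) by auto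

text \<open>
  In a rectangular relation two vertices with a common successor have the same successors.
  Identifying such twins yields a smaller totally rectangular relation, unless the relation
  already is a permutation; colourings of the smaller relation lift back.
\<close>

definition out_rep :: "'a rel \<Rightarrow> 'a \<Rightarrow> 'a" where
  "out_rep E x = (SOME y. E `` {y} = E `` {x})"

text \<open>Vertices without successors are dropped, so a walk of the reduction yields a walk of
  \<open>E\<close> with one more step. This drives the induction on walk length.\<close>

definition twin_reduction :: "'a rel \<Rightarrow> 'a rel" where
  "twin_reduction E = {(x, out_rep E y) | x y. (x, y) \<in> E \<and> y \<in> Domain E \<and> x \<in> out_rep E ` Domain E}"

lemma Image_out_rep: "E `` {out_rep E x} = E `` {x}"
  unfolding out_rep_def by (rule someI[of _ x]) simp

lemma out_rep_arc: "(out_rep E x, y) \<in> E \<longleftrightarrow> (x, y) \<in> E"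
  using Image_out_rep[of E x] by (auto simp: set_eq_iff)

lemma out_rep_cong: "E `` {x} = E `` {y} \<Longrightarrow> out_rep E x = out_rep E y"
  by (simp add: out_rep_def)

lemma out_rep_Domain: "x \<in> Domain E \<Longrightarrow> out_rep E x \<in> Domain E"
  by (auto simp: Domain_iff out_rep_arc)

text \<open>Intermediate vertices of a walk may be replaced by their representatives, since twins
  have the same successors.\<close>

lemma relpow_twin_reduction:
  "(x, z) \<in> twin_reduction E ^^ Suc k \<longleftrightarrow>
    x \<in> out_rep E ` Domain E \<and> (\<exists>y\<in>Domain E. (x, y) \<in> E ^^ Suc k \<and> out_rep E y = z)"
proof (induction k arbitrary: z)
  case 0
  show ?case by (auto simp: twin_reduction_def)
next
  case (Suc k)
  show ?case (is "?l \<longleftrightarrow> ?r")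
  proof
    assume ?l
    then obtain u where u: "(x, u) \<in> twin_reduction E ^^ Suc k" "(u, z) \<in> twin_reduction E"
      by (rule relpow_Suc_E)
    from u(1)[unfolded Suc.IH] obtain y where x: "x \<in> out_rep E ` Domain E"
      and y: "(x, y) \<in> E ^^ Suc k" "out_rep E y = u" by blast
    from u(2) obtain y' where y': "(u, y') \<in> E" "y' \<in> Domain E" "out_rep E y' = z"
      by (auto simp: twin_reduction_def)
    have "(y, y') \<in> E" using y'(1) y(2) out_rep_arc by metis
    from relpow_Suc_I[OF y(1) this] show ?r using x y' by blast
  next
    assume r: ?r
    then obtain y where y: "y \<in> Domain E" "(x, y) \<in> E ^^ Suc (Suc k)" "out_rep E y = z" by blast
    from y(2) obtain u where u: "(x, u) \<in> E ^^ Suc k" "(u, y) \<in> E" by (rule relpow_Suc_E)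
    have "u \<in> Domain E" using u(2) by blast
    then have "(x, out_rep E u) \<in> twin_reduction E ^^ Suc k" using Suc.IH r u(1) by blast
    moreover have "(out_rep E u, z) \<in> twin_reduction E"
      using y u(2) \<open>u \<in> Domain E\<close> unfolding twin_reduction_def by (auto simp: out_rep_arc)
    ultimately show ?l by (rule relpow_Suc_I)
  qed
qed

text \<open>End vertices with a common representative have a common successor, so rectangularity
  applies to the walks of \<open>E\<close> prolonged by one step. The last step is then removed
  again, up to twins.\<close>

lemma totally_rectangular_twin_reduction:
  assumes E: "totally_rectangular E"
  shows "totally_rectangular (twin_reduction E)"
  unfolding totally_rectangular_def
proof (intro allI impI)
  fix k a b c d
  assume ac: "(a, c) \<in> twin_reduction E ^^ k" and bc: "(b, c) \<in> twin_reduction E ^^ k"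
    and bd: "(b, d) \<in> twin_reduction E ^^ k"
  show "(a, d) \<in> twin_reduction E ^^ k"
  proof (cases k)
    case 0
    then show ?thesis using ac bc bd by simp
  next
    case (Suc j)
    from ac obtain y1 where a: "a \<in> out_rep E ` Domain E"
      and y1: "y1 \<in> Domain E" "(a, y1) \<in> E ^^ k" "out_rep E y1 = c"
      unfolding Suc relpow_twin_reduction by blast
    from bc obtain y2 where y2: "(b, y2) \<in> E ^^ k" "out_rep E y2 = c"
      unfolding Suc relpow_twin_reduction by blast
    from bd obtain y3 where y3: "y3 \<in> Domain E" "(b, y3) \<in> E ^^ k" "out_rep E y3 = d"
      unfolding Suc relpow_twin_reduction by blast
    obtain w v where w: "(y1, w) \<in> E" and v: "(y3, v) \<in> E" using y1(1) y3(1) by blast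
    have "(y2, w) \<in> E" using w y1(3) y2(2) out_rep_arc by metis
    then have "(a, w) \<in> E ^^ Suc k" "(b, w) \<in> E ^^ Suc k" "(b, v) \<in> E ^^ Suc k"
      using relpow_Suc_I y1(2) y2(1) y3(2) w v by metis+
    then have "(a, v) \<in> E ^^ Suc k" by (rule totally_rectangularD[OF E])
    then obtain y4 where y4: "(a, y4) \<in> E ^^ k" "(y4, v) \<in> E" by (rule relpow_Suc_E)
    have "out_rep E y4 = d"
      using out_rep_cong[OF totally_rectangular_Image_eq[OF E y4(2) v]] y3(3) by simp
    then show ?thesis unfolding Suc relpow_twin_reduction using a y4 Suc by blast
  qed
qed

section \<open>Colourings of totally rectangular relations\<close>

text \<open>A vertex with successors takes the colour of its representative, a sink the colour
  following that of a predecessor. All predecessors of a vertex are twins, so the choice among them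
  does not matter.\<close>

lemma coloring_lift:
  assumes E: "totally_rectangular E"
    and c': "\<And>x y. (x, y) \<in> twin_reduction E \<Longrightarrow> c' y = s (c' x)"
  shows "\<exists>c. (\<forall>x y. (x, y) \<in> E \<longrightarrow> c y = s (c x)) \<and> (\<forall>x. c x \<in> range c' \<union> s ` range c')"
proof -
  define c where "c x = (if x \<in> Domain E then c' (out_rep E x)
    else if x \<in> Range E then s (c' (out_rep E (SOME w. (w, x) \<in> E))) else c' x)" for x
  have "c y = s (c x)" if xy: "(x, y) \<in> E" for x y
  proof -
    have x: "x \<in> Domain E" and y: "y \<in> Range E" using xy by blast+
    show ?thesis
    proof (cases "y \<in> Domain E")
      case True
      have "(out_rep E x, out_rep E y) \<in> twin_reduction E"
        using x xy True unfolding twin_reduction_def by (auto simp: out_rep_arc)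
      then show ?thesis using c' x True by (simp add: c_def)
    next
      case False
      have "(SOME w. (w, y) \<in> E, y) \<in> E" using xy by (rule someI)
      from out_rep_cong[OF totally_rectangular_Image_eq[OF E this xy]]
      show ?thesis using x y False by (simp add: c_def)
    qed
  qed
  moreover have "c x \<in> range c' \<union> s ` range c'" for x by (simp add: c_def)
  ultimately show ?thesis by blast
qed

text \<open>Reduction shortens the longest walks by one, and lifting raises the largest colour by at
  most one.\<close>

lemma bounded_walk_coloring:
  assumes "totally_rectangular E" "E ^^ Suc m = {}"
  shows "\<exists>c :: 'a \<Rightarrow> nat. (\<forall>x y. (x, y) \<in> E \<longrightarrow> c y = Suc (c x)) \<and> (\<forall>x. c x \<le> m)"
  using assms
proof (induction m arbitrary: E)
  case 0
  then show ?case by (intro exI[of _ "\<lambda>x. 0"]) simp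
next
  case (Suc m)
  have "twin_reduction E ^^ Suc m = {}"
  proof (rule ccontr)
    assume "twin_reduction E ^^ Suc m \<noteq> {}"
    then obtain x z where "(x, z) \<in> twin_reduction E ^^ Suc m" by fast
    then obtain y where "y \<in> Domain E" "(x, y) \<in> E ^^ Suc m"
      unfolding relpow_twin_reduction by blast
    then obtain w where "(x, w) \<in> E ^^ Suc (Suc m)" using relpow_Suc_I by (metis DomainE)
    then show False using Suc.prems(2) by blast
  qed
  then obtain c' :: "'a \<Rightarrow> nat" where c': "\<And>x y. (x, y) \<in> twin_reduction E \<Longrightarrow> c' y = Suc (c' x)" "\<And>x. c' x \<le> m"
    using Suc.IH totally_rectangular_twin_reduction[OF Suc.prems(1)] by blast
  obtain c where c: "\<And>x y. (x, y) \<in> E \<Longrightarrow> c y = Suc (c x)" "\<And>x. c x \<in> range c' \<union> Suc ` range c'"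
    using coloring_lift[OF Suc.prems(1), of c' Suc] c'(1) by blast
  have "c x \<le> Suc m" for x
    using c(2)[of x] c'(2) by (auto intro: le_SucI)
  then show ?case using c(1) by blast
qed

text \<open>Reduce until the number of vertices no longer drops. Then every vertex has a successor
  and no two vertices are twins, so the relation is the graph of a permutation with periods
  divisible by \<open>n\<close>.\<close>

lemma cyclic_coloring:
  assumes "finite V" "E \<subseteq> V \<times> V" "totally_rectangular E" "n \<ge> 1"
    and "\<And>x k. (x, x) \<in> E ^^ k \<Longrightarrow> n dvd k"
  shows "\<exists>c :: 'a \<Rightarrow> nat. \<forall>x y. (x, y) \<in> E \<longrightarrow> c y = Suc (c x) mod n"
  using assms(1-3,5)
proof (induction "card V" arbitrary: V E rule: less_induct)
  case less
  note fin = less.prems(1) and EV = less.prems(2) and rect = less.prems(3) and closed = less.prems(4)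
  define R where "R = out_rep E ` Domain E"
  have DV: "Domain E \<subseteq> V" using EV by blast
  have RD: "R \<subseteq> Domain E" unfolding R_def by (auto intro: out_rep_Domain simp del: Domain_iff)
  have finD: "finite (Domain E)" using DV fin finite_subset by blast
  then have finR: "finite R" by (simp add: R_def)
  show ?case
  proof (cases "card R < card V")
    case True
    have sub: "twin_reduction E \<subseteq> R \<times> R" by (auto simp: twin_reduction_def R_def)
    have cl: "n dvd k" if h: "(x, x) \<in> twin_reduction E ^^ k" for x k
    proof (cases k)
      case (Suc j)
      from h[unfolded Suc relpow_twin_reduction] obtain y where y: "(x, y) \<in> E ^^ Suc j" "out_rep E y = x"
        by blast
      from y(1) obtain z where z: "(x, z) \<in> E" "(z, y) \<in> E ^^ j" by (rule relpow_Suc_E2)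
      \<comment> \<open>As \<open>x\<close> represents \<open>y\<close>, the walk from
        \<open>x\<close> to \<open>y\<close> can start at \<open>y\<close> instead, which closes it
        in \<open>E\<close>.\<close>
      have "(y, z) \<in> E" using z(1) y(2) out_rep_arc by metis
      from relpow_Suc_I2[OF this z(2)] show ?thesis unfolding Suc by (rule closed)
    qed simp
    have "\<exists>c' :: 'a \<Rightarrow> nat. \<forall>x y. (x, y) \<in> twin_reduction E \<longrightarrow> c' y = Suc (c' x) mod n"
      by (rule less.hyps[OF True finR sub totally_rectangular_twin_reduction[OF rect]]) (rule cl)
    then obtain c' :: "'a \<Rightarrow> nat" where "\<And>x y. (x, y) \<in> twin_reduction E \<Longrightarrow> c' y = Suc (c' x) mod n"
      by blast
    then show ?thesis using coloring_lift[OF rect, of c' "\<lambda>i. Suc i mod n"] by blast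
  next
    case False
    have "card R \<le> card (Domain E)" "card (Domain E) \<le> card V"
      using RD DV fin finD by (simp_all add: card_mono)
    with False have cards: "card R = card (Domain E)" "card (Domain E) = card V" by simp_all
    have D: "Domain E = V" using card_subset_eq[OF fin DV] cards by simp
    have "inj_on (out_rep E) (Domain E)" using cards(1) finD unfolding R_def by (intro eq_card_imp_inj_on)
    then have unique: "x = x'" if "(x, y) \<in> E" "(x', y) \<in> E" for x x' y
      using that out_rep_cong[OF totally_rectangular_Image_eq[OF rect that]] by (auto dest: inj_onD)
    have "\<forall>x. \<exists>y. x \<in> V \<longrightarrow> (x, y) \<in> E" using D by blast
    then obtain s where s: "\<And>x. x \<in> V \<Longrightarrow> (x, s x) \<in> E" by metis
    have sV: "s ` V \<subseteq> V" using s EV by blast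
    have inj: "inj_on s V" using s unique by (intro inj_onI) metis
    have surj: "s ` V = V" using endo_inj_surj[OF fin sV inj] .
    have Es: "y = s x" if "(x, y) \<in> E" for x y
    proof -
      have "y \<in> s ` V" using that EV surj by blast
      then obtain x' where x': "x' \<in> V" "y = s x'" by blast
      then have "x = x'" using unique[OF that] s by simp
      then show ?thesis using x' by simp
    qed
    have walk: "(s ^^ d) x \<in> V \<and> (x, (s ^^ d) x) \<in> E ^^ d" if "x \<in> V" for x d
    proof (induction d)
      case (Suc d)
      then show ?case using s sV relpow_Suc_I[of x "(s ^^ d) x" d E] by (auto simp del: relpow.simps)
    qed (use that in simp)
    have "n dvd d" if "x \<in> V" "(s ^^ d) x = x" for x d
      using closed[of x d] walk[OF that(1), of d] that(2) by simp
    then obtain c :: "'a \<Rightarrow> nat" where c: "\<And>x. x \<in> V \<Longrightarrow> c (s x) = Suc (c x) mod n"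
      using permutation_cyclic_coloring[OF inj sV assms(4)] by blast
    show ?thesis
    proof (intro exI allI impI)
      fix x y assume xy: "(x, y) \<in> E"
      then show "c y = Suc (c x) mod n" using Es[OF xy] c[of x] EV by auto
    qed
  qed
qed

section \<open>Retracts with a Maltsev operation\<close>

lemma idempotent_power:
  assumes V: "finite V" and d: "d ` V \<subseteq> V"
  shows "\<exists>N\<ge>1. \<forall>x\<in>V. (d ^^ N) ((d ^^ N) x) = (d ^^ N) x"
proof -
  have pow_V: "(d ^^ i) x \<in> V" if "x \<in> V" for x i
    using that d by (induction i) auto
  have "range (\<lambda>i. restrict (d ^^ i) V) \<subseteq> V \<rightarrow>\<^sub>E V" using pow_V by auto
  then have "finite (range (\<lambda>i. restrict (d ^^ i) V))"
    using V finite_PiE[of V "\<lambda>_. V"] finite_subset by blast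
  then have "\<not> inj (\<lambda>i. restrict (d ^^ i) V)" using finite_imageD by blast
  then obtain i j where "restrict (d ^^ i) V = restrict (d ^^ j) V" "i \<noteq> j" by (auto simp: inj_on_def)
  then obtain i j where ij: "restrict (d ^^ i) V = restrict (d ^^ j) V" "i < j"
    by (metis linorder_neq_iff)
  define P where "P = j - i"
  have P: "P \<ge> 1" "j = i + P" using ij(2) by (simp_all add: P_def)
  have base: "(d ^^ (i + P)) x = (d ^^ i) x" if "x \<in> V" for x
    using fun_cong[OF ij(1), of x] that P(2) by simp
  have step: "(d ^^ (m + P)) x = (d ^^ m) x" if "x \<in> V" "m \<ge> i" for x m
  proof -
    have "(d ^^ (m + P)) x = (d ^^ ((m - i) + (i + P))) x" using that(2) by simp
    also have "\<dots> = (d ^^ (m - i)) ((d ^^ (i + P)) x)" by (simp only: funpow_add comp_apply)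
    also have "\<dots> = (d ^^ (m - i)) ((d ^^ i) x)" by (simp only: base[OF that(1)])
    also have "\<dots> = (d ^^ ((m - i) + i)) x" by (simp only: funpow_add comp_apply)
    finally show ?thesis using that(2) by simp
  qed
  have steps: "(d ^^ (m + t * P)) x = (d ^^ m) x" if "x \<in> V" "m \<ge> i" for x m t
  proof (induction t)
    case (Suc t)
    have "(d ^^ (m + Suc t * P)) x = (d ^^ ((m + t * P) + P)) x" by (simp add: algebra_simps)
    then show ?case using step[OF that(1), of "m + t * P"] that(2) Suc by simp
  qed simp
  \<comment> \<open>\<open>N\<close> is a multiple of the eventual period \<open>P\<close> and at
    least the preperiod \<open>i\<close>.\<close>
  define N where "N = Suc i * P"
  have N: "N \<ge> 1" "N \<ge> i"
    unfolding N_def using P(1) by (simp, metis Suc_leD le_trans mult.right_neutral mult_le_mono2)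
  have "(d ^^ N) ((d ^^ N) x) = (d ^^ N) x" if "x \<in> V" for x
  proof -
    have "(d ^^ N) ((d ^^ N) x) = (d ^^ (N + N)) x" by (simp only: funpow_add comp_apply)
    also have "\<dots> = (d ^^ N) x" using steps[OF that N(2), of "Suc i"] by (simp only: N_def)
    finally show ?thesis .
  qed
  then show ?thesis using N(1) by blast
qed

lemma relpow_ternary:
  assumes "\<And>x x' y y' z z'. (x, x') \<in> E \<Longrightarrow> (y, y') \<in> E \<Longrightarrow> (z, z') \<in> E \<Longrightarrow> (m x y z, m x' y' z') \<in> E"
  shows "(x, x') \<in> E ^^ k \<Longrightarrow> (y, y') \<in> E ^^ k \<Longrightarrow> (z, z') \<in> E ^^ k \<Longrightarrow> (m x y z, m x' y' z') \<in> E ^^ k"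
proof (induction k arbitrary: x' y' z')
  case (Suc k)
  obtain u v w where "(x, u) \<in> E ^^ k" "(y, v) \<in> E ^^ k" "(z, w) \<in> E ^^ k"
    "(u, x') \<in> E" "(v, y') \<in> E" "(w, z') \<in> E"
    using Suc.prems by (meson relpow_Suc_E)
  then show ?case using Suc.IH assms relpow_Suc_I by metis
qed simp

text \<open>The diagonal \<open>d\<close> of \<open>f\<close> is an endomorphism, and a power of it
  is a retraction onto its image \<open>H\<close>. On \<open>H\<close> the diagonal is invertible,
  so \<open>f\<close> can be corrected to a Maltsev operation, which makes all walk relations on
  \<open>H\<close> rectangular.\<close>

lemma quasi_maltsev_retract:
  assumes A: "finite_digraph A" and f: "quasi_maltsev A f"
  shows "\<exists>e E. E \<subseteq> parcs A \<and> totally_rectangular E \<and> (\<forall>x y. arc A x y \<longrightarrow> (e x, e y) \<in> E)"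
proof -
  note fA = finite_digraphD[OF A]
  define V where "V = pverts A"
  have p: "pol A 3 f" and eq: "\<And>x y. x \<in> V \<Longrightarrow> y \<in> V \<Longrightarrow> f [x, y, y] = f [x, x, x] \<and> f [y, y, x] = f [x, x, x]"
    using f unfolding quasi_maltsev_def V_def by blast+
  have f_arc: "arc A (f [x, y, z]) (f [x', y', z'])" if "arc A x x'" "arc A y y'" "arc A z z'" for x y z x' y' z'
    by (rule pol_arc[OF p]) (use that in \<open>auto simp: less_Suc_eq numeral_3_eq_3\<close>)
  have fV: "f [x, y, z] \<in> V" if "x \<in> V" "y \<in> V" "z \<in> V" for x y z
    unfolding V_def by (rule pol_in[OF p]) (use that in \<open>auto simp: nlists_def V_def\<close>)
  define d where "d x = f [x, x, x]" for x
  have dV: "d ` V \<subseteq> V" using fV by (auto simp: d_def)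
  have powV: "(d ^^ i) x \<in> V" if "x \<in> V" for i x using that dV by (induction i) auto
  have pow_arc: "arc A ((d ^^ i) x) ((d ^^ i) y)" if "arc A x y" for i x y
    using that by (induction i) (auto simp: d_def intro: f_arc)
  obtain N where N: "N \<ge> 1" "\<And>x. x \<in> V \<Longrightarrow> (d ^^ N) ((d ^^ N) x) = (d ^^ N) x"
    using idempotent_power[OF fA(2), of d] dV unfolding V_def by blast
  define H where "H = (d ^^ N) ` V"
  define E where "E = parcs A \<inter> H \<times> H"
  have HV: "H \<subseteq> V" using powV by (auto simp: H_def)
  have fix_H: "(d ^^ N) x = x" if "x \<in> H" for x using that N(2) by (auto simp: H_def)
  \<comment> \<open>In the identities \<open>f\<close> returns \<open>d x\<close>; the inner power
    completes this to \<open>(d ^^ N) x\<close>, which is \<open>x\<close> on \<open>H\<close>. The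
    outer power brings all values into \<open>H\<close>.\<close>
  define m where "m x y z = (d ^^ N) ((d ^^ (N - 1)) (f [x, y, z]))" for x y z
  have m_id: "m x y y = x" "m y y x = x" if "x \<in> H" "y \<in> H" for x y
  proof -
    have xy: "x \<in> V" "y \<in> V" using that HV by auto
    have "(d ^^ (N - 1)) (d x) = (d ^^ N) x"
      using N(1) by (cases N) (simp_all add: funpow_swap1)
    then have "(d ^^ N) ((d ^^ (N - 1)) (f [x, x, x])) = x" using fix_H[OF that(1)] by (simp add: d_def)
    then show "m x y y = x" "m y y x = x" unfolding m_def using eq[OF xy] by simp_all
  qed
  have m_E: "(m x y z, m x' y' z') \<in> E" if "(x, x') \<in> E" "(y, y') \<in> E" "(z, z') \<in> E" for x y z x' y' z'
  proof -
    have "arc A (m x y z) (m x' y' z')"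
      unfolding m_def using that by (intro pow_arc f_arc) (simp_all add: E_def)
    moreover have "m x y z \<in> H" "m x' y' z' \<in> H"
      unfolding m_def H_def using that HV by (auto simp: E_def intro!: imageI powV fV)
    ultimately show ?thesis by (simp add: E_def)
  qed
  have "totally_rectangular E"
    unfolding totally_rectangular_def
  proof (intro allI impI)
    fix k a b c e
    assume h: "(a, c) \<in> E ^^ k" "(b, c) \<in> E ^^ k" "(b, e) \<in> E ^^ k"
    show "(a, e) \<in> E ^^ k"
    \<comment> \<open>Walks with at least one step have their ends in \<open>H\<close>, where
      \<open>m\<close> is Maltsev. For \<open>k = 0\<close> the vertices may lie outside
      \<open>H\<close>, but the relation is equality.\<close>
    proof (cases k)
      case 0
      then show ?thesis using h by simp
    next
      case (Suc j)
      have in_H: "x \<in> H \<and> y \<in> H" if "(x, y) \<in> E ^^ Suc j" for x y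
      proof -
        from that obtain u where "(u, y) \<in> E" by (rule relpow_Suc_E)
        moreover from that obtain v where "(x, v) \<in> E" by (rule relpow_Suc_E2)
        ultimately show ?thesis by (auto simp: E_def)
      qed
      have "a \<in> H" "b \<in> H" "c \<in> H" "e \<in> H" using in_H h unfolding Suc by blast+
      moreover have "(m a b b, m c c e) \<in> E ^^ k" by (rule relpow_ternary[OF m_E h])
      ultimately show ?thesis using m_id by simp
    qed
  qed
  moreover have "((d ^^ N) x, (d ^^ N) y) \<in> E" if "arc A x y" for x y
    using pow_arc[OF that] structure_digraph_arcD[OF fA(1) that] by (auto simp: E_def H_def V_def)
  ultimately show ?thesis unfolding E_def by blast
qed

section \<open>Digraphs below a cycle of prime length\<close>

lemma closed_walk_of_relpow:
  assumes "(x, x) \<in> E ^^ n" "n \<ge> 1"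
  shows "\<exists>w. closed_walk E n w"
proof -
  obtain f where f: "f 0 = x" "f n = x" "\<And>i. i < n \<Longrightarrow> (f i, f (Suc i)) \<in> E"
    using assms(1) unfolding relpow_fun_conv by blast
  have "(f (i mod n), f (Suc i mod n)) \<in> E" for i
  proof (cases "Suc (i mod n) = n")
    case True
    then have "Suc i mod n = 0" by (metis mod_Suc)
    then show ?thesis using f(3)[of "i mod n"] True f(1,2) assms(2) by simp
  next
    case False
    then have "Suc i mod n = Suc (i mod n)" by (simp add: mod_Suc)
    then show ?thesis using f(3)[of "i mod n"] assms(2) by simp
  qed
  then show ?thesis unfolding closed_walk_def by (intro exI[of _ "\<lambda>i. f (i mod n)"]) simp
qed

lemma relpow_subset:
  fixes E F :: "'a rel"
  shows "E \<subseteq> F \<Longrightarrow> E ^^ k \<subseteq> F ^^ k"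
  by (induction k) (auto intro: relcompI)

lemma long_relpow_closed:
  assumes V: "finite V" "E \<subseteq> V \<times> V" and xy: "(x, y) \<in> E ^^ Suc (card V)"
  shows "\<exists>z k. k \<ge> 1 \<and> (z, z) \<in> E ^^ k"
proof -
  obtain f where f: "\<And>i. i < Suc (card V) \<Longrightarrow> (f i, f (Suc i)) \<in> E"
    using xy unfolding relpow_fun_conv by blast
  have "f i \<in> V" if "i \<le> card V" for i using f[of i] V(2) that by auto
  then have "f ` {..card V} \<subseteq> V" by auto
  then have "\<not> inj_on f {..card V}"
    using card_inj_on_le[of f "{..card V}" V] V(1) by auto
  then obtain i j where ij: "i \<le> card V" "j \<le> card V" "f i = f j" "i \<noteq> j" by (auto simp: inj_on_def)
  then obtain i j where ij: "i < j" "j \<le> card V" "f i = f j" by (metis linorder_neq_iff)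
  have "(f i, f j) \<in> E ^^ (j - i)"
    unfolding relpow_fun_conv
  proof (intro exI[of _ "\<lambda>k. f (i + k)"] conjI allI impI)
    fix k assume "k < j - i"
    then show "(f (i + k), f (i + Suc k)) \<in> E" using f[of "i + k"] ij(2) by simp
  qed (use ij in simp_all)
  then show ?thesis using ij(1,3) by (intro exI[of _ "f i"] exI[of _ "j - i"]) simp
qed

text \<open>A longest walk of the retract maps the levelling path back into \<open>A\<close>, so
  \<open>A\<close> is homomorphically equivalent to a path. There the minimum is a symmetric
  polymorphism of every positive arity.\<close>

lemma acyclic_quasi_maltsev_cyclic_pol:
  assumes A: "finite_digraph A" and f: "quasi_maltsev A f"
    and acyc: "\<And>x k. k \<ge> 1 \<Longrightarrow> (x, x) \<notin> parcs A ^^ k" and r: "r \<ge> 1"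
  shows "\<exists>g. cyclic_pol A r g"
proof -
  note fA = finite_digraphD[OF A]
  obtain e E where E: "E \<subseteq> parcs A" "totally_rectangular E" "\<And>x y. arc A x y \<Longrightarrow> (e x, e y) \<in> E"
    using quasi_maltsev_retract[OF A f] by blast
  have EV: "E \<subseteq> pverts A \<times> pverts A" using E(1) fA(4) by blast
  have "E ^^ Suc (card (pverts A)) = {}"
  proof (rule ccontr)
    assume "E ^^ Suc (card (pverts A)) \<noteq> {}"
    then obtain x y where "(x, y) \<in> E ^^ Suc (card (pverts A))" by fast
    from long_relpow_closed[OF fA(2) EV this] obtain z k where "k \<ge> 1" "(z, z) \<in> E ^^ k" by blast
    moreover have "E ^^ k \<subseteq> parcs A ^^ k" by (rule relpow_subset) (rule E(1))
    ultimately show False using acyc by blast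
  qed
  then have ex: "\<exists>m. E ^^ Suc m = {}" by blast
  \<comment> \<open>\<open>M\<close> is the length of a longest walk in \<open>E\<close>. For
    \<open>M = 0\<close> the relation is empty and any vertex serves as the walk.\<close>
  define M where "M = (LEAST m. E ^^ Suc m = {})"
  have EM: "E ^^ Suc M = {}" unfolding M_def using ex by (rule LeastI_ex)
  have "\<exists>w. (\<forall>i<M. (w i, w (Suc i)) \<in> E) \<and> (\<forall>i\<le>M. w i \<in> pverts A)"
  proof (cases M)
    case 0
    obtain v where "v \<in> pverts A" using fA(3) by blast
    then show ?thesis using 0 by (intro exI[of _ "\<lambda>_. v"]) simp
  next
    case (Suc k)
    have "E ^^ Suc k \<noteq> {}" using not_less_Least[of k "\<lambda>m. E ^^ Suc m = {}"] Suc unfolding M_def by simp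
    then obtain x y where "(x, y) \<in> E ^^ M" unfolding Suc by fast
    then obtain w where w: "\<And>i. i < M \<Longrightarrow> (w i, w (Suc i)) \<in> E" unfolding relpow_fun_conv by blast
    have "w i \<in> pverts A" if "i \<le> M" for i
    proof (cases "i = M")
      case True
      then show ?thesis using w[of k] EV Suc by auto
    next
      case False
      then show ?thesis using w[of i] EV that by auto
    qed
    then show ?thesis using w by blast
  qed
  then obtain w where w: "\<And>i. i < M \<Longrightarrow> (w i, w (Suc i)) \<in> E" "\<And>i. i \<le> M \<Longrightarrow> w i \<in> pverts A" by blast
  obtain c :: "'a \<Rightarrow> nat" where c: "\<And>x y. (x, y) \<in> E \<Longrightarrow> c y = Suc (c x)" "\<And>x. c x \<le> M"
    using bounded_walk_coloring[OF E(2) EM] by blast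
  define g where "g xs = w (Min (set (map (\<lambda>x. c (e x)) xs)))" for xs
  have Min_le: "Min (set (map (\<lambda>x. c (e x)) xs)) \<le> M" if "xs \<noteq> []" for xs
  proof -
    have "Min (set (map (\<lambda>x. c (e x)) xs)) \<in> set (map (\<lambda>x. c (e x)) xs)" using that by (intro Min_in) simp_all
    then show ?thesis using c(2) by auto
  qed
  have "cyclic_pol A r g"
    unfolding cyclic_pol_def
  proof (intro conjI ballI polI)
    fix xs assume "xs \<in> nlists r (pverts A)"
    then have "xs \<noteq> []" using r nlistsE_length by fastforce
    then show "g xs \<in> pverts A" unfolding g_def using Min_le w(2) by blast
    show "g (rotate1 xs) = g xs" by (simp add: g_def)
  next
    fix xs ys assume l: "length xs = r" "length ys = r" and a: "\<And>i. i < r \<Longrightarrow> arc A (xs ! i) (ys ! i)"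
    have ne: "xs \<noteq> []" "ys \<noteq> []" using l r by auto
    have "map (\<lambda>x. c (e x)) ys = map Suc (map (\<lambda>x. c (e x)) xs)"
      using l c(1)[OF E(3)[OF a]] by (simp add: list_eq_iff_nth_eq)
    then have "Min (set (map (\<lambda>x. c (e x)) ys)) = Min (Suc ` set (map (\<lambda>x. c (e x)) xs))"
      by (simp only: set_map)
    also have "\<dots> = Suc (Min (set (map (\<lambda>x. c (e x)) xs)))"
      using ne by (intro mono_Min_commute[symmetric]) (simp_all add: mono_def)
    finally have eq: "Min (set (map (\<lambda>x. c (e x)) ys)) = Suc (Min (set (map (\<lambda>x. c (e x)) xs)))" .
    \<comment> \<open>The minimal level of the targets, one higher, is still at most
      \<open>M\<close>, so the walk has another step.\<close>
    then have "Min (set (map (\<lambda>x. c (e x)) xs)) < M" using Min_le[OF ne(2)] by simp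
    from w(1)[OF this] show "arc A (g xs) (g ys)" using E(1) unfolding g_def eq by blast
  qed
  then show ?thesis by blast
qed

text \<open>A prime divisor of the length other than \<open>p\<close> is cancelled by a cyclic
  polymorphism of that arity; when none is left, the length is a power of \<open>p\<close>.\<close>

lemma prime_power_closed_walk:
  fixes p :: nat
  assumes A: "structure_digraph A" and p: "prime p"
    and cyc: "\<And>q. prime q \<Longrightarrow> q \<noteq> p \<Longrightarrow> \<exists>f. cyclic_pol A q f"
  shows "L \<ge> 1 \<Longrightarrow> closed_walk (parcs A) L w \<Longrightarrow> \<exists>j u. p ^ j dvd L \<and> closed_walk (parcs A) (p ^ j) u"
proof (induction L arbitrary: w rule: less_induct)
  case (less L)
  show ?case
  proof (cases "\<exists>r. prime r \<and> r \<noteq> p \<and> r dvd L")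
    case True
    then obtain r m where r: "prime r" "r \<noteq> p" "L = r * m" by blast
    have r1: "r > 1" using r(1) prime_gt_1_nat by blast
    obtain f where "cyclic_pol A r f" using cyc r by blast
    from closed_walk_cyclic_pol[OF A this _ less.prems(2)[unfolded r(3)]] r1
    obtain u where "closed_walk (parcs A) m u" by auto
    moreover have "m < L" "m \<ge> 1" using less.prems(1) r(3) r1 by simp_all
    ultimately show ?thesis using less.IH r(3) by (meson dvd_mult)
  next
    case False
    have "L \<noteq> 0" "\<not> is_unit p" using less.prems(1) p by auto
    then obtain y where y: "L = p ^ multiplicity p L * y" "\<not> p dvd y" by (rule multiplicity_decompose')
    have "y = 1"
    proof (rule ccontr)
      assume "y \<noteq> 1"
      then obtain r where "prime r" "r dvd y" using prime_factor_nat by blast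
      moreover from this have "r \<noteq> p" using y(2) by blast
      moreover have "r dvd L" using \<open>r dvd y\<close> y(1) by (metis dvd_mult)
      ultimately show False using False by blast
    qed
    then have "L = p ^ multiplicity p L" using y(1) by simp
    then show ?thesis using less.prems(2) by (metis dvd_refl)
  qed
qed

text \<open>Let \<open>n\<close> be the least power of \<open>p\<close> that is the length of a
  closed walk in \<open>A\<close>. It divides the length of every closed walk of the retract, which
  can therefore be coloured modulo \<open>n\<close>; the walk of length \<open>n\<close> gives the
  homomorphism back.\<close>

lemma quasi_maltsev_hom_equivalent_cycle:
  fixes p :: nat
  assumes A: "finite_digraph A" and f: "quasi_maltsev A f" and p: "prime p"
    and cyc: "\<And>q. prime q \<Longrightarrow> q \<noteq> p \<Longrightarrow> \<exists>f. cyclic_pol A q f"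
    and x: "(x, x) \<in> parcs A ^^ L" "L \<ge> 1"
  shows "\<exists>k. hom_equivalent (directed_cycle (p ^ k)) A"
proof -
  note fA = finite_digraphD[OF A]
  have ppow: "\<exists>j u. p ^ j dvd l \<and> closed_walk (parcs A) (p ^ j) u"
    if "l \<ge> 1" "closed_walk (parcs A) l w" for l w
    by (rule prime_power_closed_walk[OF fA(1) p _ that]) (rule cyc)
  obtain e E where E: "E \<subseteq> parcs A" "totally_rectangular E" "\<And>x y. arc A x y \<Longrightarrow> (e x, e y) \<in> E"
    using quasi_maltsev_retract[OF A f] by blast
  have EV: "E \<subseteq> pverts A \<times> pverts A" using E(1) fA(4) by blast
  let ?P = "\<lambda>k. \<exists>u. closed_walk (parcs A) (p ^ k) u"
  define k where "k = (LEAST k. ?P k)"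
  define n where "n = p ^ k"
  have n1: "n \<ge> 1" using p by (simp add: n_def prime_gt_0_nat Suc_leI)
  obtain w0 where "closed_walk (parcs A) L w0" using closed_walk_of_relpow[OF x] by blast
  from ppow[OF x(2) this] have "\<exists>k. ?P k" by blast
  then have "?P k" unfolding k_def by (rule LeastI_ex)
  then obtain w where w: "closed_walk (parcs A) n w" unfolding n_def by blast
  have "n dvd l" if yl: "(y, y) \<in> E ^^ l" for y l
  proof (cases "l = 0")
    case False
    have "E ^^ l \<subseteq> parcs A ^^ l" by (rule relpow_subset) (rule E(1))
    then have "(y, y) \<in> parcs A ^^ l" using yl by blast
    then obtain u where "closed_walk (parcs A) l u" using closed_walk_of_relpow False by (metis Suc_leI neq0_conv One_nat_def)
    from ppow[OF _ this] False obtain j where j: "p ^ j dvd l" "?P j" by (auto simp: Suc_le_eq)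
    have "k \<le> j" unfolding k_def by (rule Least_le) (rule j(2))
    then show ?thesis unfolding n_def using j(1) by (meson dvd_trans le_imp_power_dvd)
  qed simp
  then obtain c :: "'a \<Rightarrow> nat" where c: "\<And>x y. (x, y) \<in> E \<Longrightarrow> c y = Suc (c x) mod n"
    using cyclic_coloring[OF fA(2) EV E(2) n1] by blast
  \<comment> \<open>Colours are reduced modulo \<open>n\<close>, since only those of vertices with a
    predecessor are known to be below \<open>n\<close>.\<close>
  have "digraph_hom A (directed_cycle n) (\<lambda>x. c (e x) mod n)"
    unfolding digraph_hom_def
  proof (intro conjI allI impI)
    show "(\<lambda>x. c (e x) mod n) ` pverts A \<subseteq> pverts (directed_cycle n)"
      using n1 by (auto simp: pverts_directed_cycle)
    fix x y assume "arc A x y"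
    from c[OF E(3)[OF this]] show "arc (directed_cycle n) (c (e x) mod n) (c (e y) mod n)"
      using n1 by (simp add: arc_directed_cycle mod_Suc_eq)
  qed
  moreover have "digraph_hom (directed_cycle n) A w"
    unfolding digraph_hom_def
  proof (intro conjI allI impI)
    have arc: "arc A (w i) (w (Suc i))" for i using w by (simp add: closed_walk_def)
    show "w ` pverts (directed_cycle n) \<subseteq> pverts A" using structure_digraph_arcD(1)[OF fA(1) arc] by blast
    fix i j assume "arc (directed_cycle n) i j"
    then have ij: "i < n" "j = Suc i mod n" by (simp_all add: arc_directed_cycle)
    have "w j = w (Suc i)"
    proof (cases "Suc i = n")
      case True
      have "w (0 + n) = w 0" using w unfolding closed_walk_def by blast
      then show ?thesis using True ij(2) by simp
    next
      case False
      then show ?thesis using ij by simp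
    qed
    then show "arc A (w i) (w j)" using arc by simp
  qed
  ultimately show ?thesis unfolding hom_equivalent_def n_def by blast
qed

text \<open>Avoiding all the listed digraphs would force enough polymorphisms to make
  \<open>Z\<close> equivalent to a cycle of length \<open>p ^ k\<close>, which lies above the cycle
  of length \<open>p\<close>.\<close>

lemma below_directed_cycle_prime:
  fixes p :: nat
  assumes p: "prime p" and Z: "finite_digraph Z" and le: "Z \<le>\<^sub>p\<^sub>p directed_cycle p"
    and nle: "\<not> directed_cycle p \<le>\<^sub>p\<^sub>p Z"
  shows "Z \<le>\<^sub>p\<^sub>p T3 \<times>\<^sub>d directed_cycle p \<or> (\<exists>q. prime q \<and> q \<noteq> p \<and> Z \<le>\<^sub>p\<^sub>p directed_cycle (p * q))"
proof (rule ccontr)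
  assume neg: "\<not> ?thesis"
  have p1: "p > 1" "p \<ge> 1" using prime_gt_1_nat[OF p] by simp_all
  note Cp = finite_directed_cycle[OF p1(2)]
  have "\<not> Z \<le>\<^sub>p\<^sub>p T3"
    using neg pp_constructs_product[OF Z finite_T3 Cp _ le] by blast
  then obtain f where f: "quasi_maltsev Z f" using pp_constructs_T3[OF Z] by blast
  have nop: "\<not> cyclic_pol Z p g" for g
    using cyclic_pol_mono[OF Z Cp le _ p1(2)] no_cyclic_pol_directed_cycle[OF p1(2) dvd_refl p1(1)] by blast
  have cyc: "\<exists>g. cyclic_pol Z q g" if q: "prime q" "q \<noteq> p" for q
  proof (rule ccontr)
    assume no: "\<nexists>g. cyclic_pol Z q g"
    \<comment> \<open>The primes dividing \<open>p * q\<close> are \<open>p\<close> and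
      \<open>q\<close>, and \<open>Z\<close> lacks cyclic polymorphisms of both arities.\<close>
    have "Z \<le>\<^sub>p\<^sub>p directed_cycle (p * q)"
    proof (rule pp_constructs_directed_cycle[OF Z])
      show "p * q \<ge> 1" using p1 prime_gt_1_nat[OF q(1)] by simp
      fix r g assume "prime r" "r dvd p * q"
      then have "r = p \<or> r = q" using p q(1) by (metis prime_dvd_mult_iff primes_dvd_imp_eq)
      then show "\<not> cyclic_pol Z r g" using nop no by blast
    qed
    then show False using neg q by blast
  qed
  have "\<exists>x L. L \<ge> 1 \<and> (x, x) \<in> parcs Z ^^ L"
    using acyclic_quasi_maltsev_cyclic_pol[OF Z f _ p1(2)] nop by blast
  then obtain k where k: "hom_equivalent (directed_cycle (p ^ k)) Z"
    using quasi_maltsev_hom_equivalent_cycle[OF Z f p] cyc by blast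
  \<comment> \<open>For \<open>k = 0\<close> the target is a loop and no prime has to be checked;
    otherwise \<open>p\<close> is the only one.\<close>
  have "directed_cycle p \<le>\<^sub>p\<^sub>p directed_cycle (p ^ k)"
  proof (rule pp_constructs_directed_cycle[OF Cp])
    show "p ^ k \<ge> 1" using p1 by simp
    fix r g assume "prime r" "r dvd p ^ k"
    then have "r = p" using p by (metis prime_dvd_power primes_dvd_imp_eq)
    then show "\<not> cyclic_pol (directed_cycle p) r g"
      using no_cyclic_pol_directed_cycle[OF p1(2) dvd_refl p1(1)] by blast
  qed
  then show False using nle pp_constructs_cong_right[OF _ k] by blast
qed

section \<open>Representatives over the natural numbers\<close>

text \<open>Classes consist of digraphs over \<open>nat\<close>, whereas the direct product has
  pairs as vertices.\<close>

lemma finite_digraph_nat_copy: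
  assumes A: "finite_digraph A"
  shows "\<exists>B :: nat pair_pre_digraph. finite_digraph B \<and> hom_equivalent A B"
proof -
  note fA = finite_digraphD[OF A]
  obtain h where h: "bij_betw h (pverts A) {0..<card (pverts A)}"
    using ex_bij_betw_finite_nat[OF fA(2)] by blast
  have inj: "inj_on h (pverts A)" using h by (simp add: bij_betw_def)
  define B where "B = \<lparr>pverts = h ` pverts A, parcs = map_prod h h ` parcs A\<rparr>"
  have "finite_digraph B"
    using fA by (intro finite_digraphI) (auto simp: B_def)
  moreover have "digraph_hom A B h" by (auto simp: digraph_hom_def B_def)
  moreover have "digraph_hom B A (the_inv_into (pverts A) h)"
    unfolding digraph_hom_def B_def using structure_digraph_arcD[OF fA(1)]
    by (auto simp: the_inv_into_f_f[OF inj])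
  ultimately show ?thesis unfolding hom_equivalent_def by blast
qed

text \<open>A digraph over another type is not a member of its own class, so a copy over
  \<open>nat\<close> links the two classes.\<close>

lemma pp_class_eq_iff:
  assumes "finite_digraph A" "finite_digraph B"
  shows "pp_class A = pp_class B \<longleftrightarrow> A \<le>\<^sub>p\<^sub>p B \<and> B \<le>\<^sub>p\<^sub>p A"
proof
  assume eq: "pp_class A = pp_class B"
  obtain C :: "nat pair_pre_digraph" where C: "finite_digraph C" "hom_equivalent A C"
    using finite_digraph_nat_copy[OF assms(1)] by blast
  have AC: "A \<le>\<^sub>p\<^sub>p C" "C \<le>\<^sub>p\<^sub>p A"
    using C hom_equivalent_imp_pp_constructs[OF assms(1)] hom_equivalent_imp_pp_constructs[OF C(1)]
      hom_equivalent_sym by blast+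
  then have "C \<in> pp_class B" unfolding eq[symmetric] using C(1) by (simp add: pp_class_def)
  then have "B \<le>\<^sub>p\<^sub>p C" "C \<le>\<^sub>p\<^sub>p B" by (simp_all add: pp_class_def)
  then show "A \<le>\<^sub>p\<^sub>p B \<and> B \<le>\<^sub>p\<^sub>p A"
    using pp_constructs_trans[OF assms(1) C(1) assms(2)] pp_constructs_trans[OF assms(2) C(1) assms(1)] AC
    by blast
next
  assume AB: "A \<le>\<^sub>p\<^sub>p B \<and> B \<le>\<^sub>p\<^sub>p A"
  have "A \<le>\<^sub>p\<^sub>p C \<and> C \<le>\<^sub>p\<^sub>p A \<longleftrightarrow> B \<le>\<^sub>p\<^sub>p C \<and> C \<le>\<^sub>p\<^sub>p B" if C: "finite_digraph C" for C :: "nat pair_pre_digraph"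
    using AB pp_constructs_trans[OF assms(1,2) C] pp_constructs_trans[OF assms(2,1) C]
      pp_constructs_trans[OF C assms(1,2)] pp_constructs_trans[OF C assms(2,1)] by blast
  then show "pp_class A = pp_class B" unfolding pp_class_def by blast
qed

section \<open>Lower covers in the poset\<close>

lemma pp_class_carrier:
  assumes "finite_digraph A" shows "pp_class A \<in> carrier P_Digraphs"
proof -
  obtain B :: "nat pair_pre_digraph" where B: "finite_digraph B" "hom_equivalent A B"
    using finite_digraph_nat_copy[OF assms] by blast
  have "pp_class A = pp_class B"
    unfolding pp_class_eq_iff[OF assms B(1)]
    using B hom_equivalent_imp_pp_constructs[OF assms] hom_equivalent_imp_pp_constructs[OF B(1)]
      hom_equivalent_sym by blast
  then show ?thesis using B(1) by (auto simp: P_Digraphs_def)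
qed

lemma le_pp_class_iff:
  assumes A: "finite_digraph A" and B: "finite_digraph B"
  shows "pp_class A \<sqsubseteq>\<^bsub>P_Digraphs\<^esub> pp_class B \<longleftrightarrow> A \<le>\<^sub>p\<^sub>p B"
proof
  assume "pp_class A \<sqsubseteq>\<^bsub>P_Digraphs\<^esub> pp_class B"
  then obtain A' B' where "A' \<in> pp_class A" "B' \<in> pp_class B" and le: "A' \<le>\<^sub>p\<^sub>p B'"
    by (auto simp: P_Digraphs_def)
  then have fin: "finite_digraph A'" "finite_digraph B'" and "A \<le>\<^sub>p\<^sub>p A'" "B' \<le>\<^sub>p\<^sub>p B"
    by (simp_all add: pp_class_def)
  then show "A \<le>\<^sub>p\<^sub>p B"
    using pp_constructs_trans[OF A fin(1) fin(2) _ le] pp_constructs_trans[OF A fin(2) B] by blast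
next
  assume le: "A \<le>\<^sub>p\<^sub>p B"
  obtain A' :: "nat pair_pre_digraph" where A': "finite_digraph A'" "hom_equivalent A A'"
    using finite_digraph_nat_copy[OF A] by blast
  obtain B' :: "nat pair_pre_digraph" where B': "finite_digraph B'" "hom_equivalent B B'"
    using finite_digraph_nat_copy[OF B] by blast
  have AA': "A \<le>\<^sub>p\<^sub>p A'" "A' \<le>\<^sub>p\<^sub>p A"
    by (rule hom_equivalent_imp_pp_constructs[OF A A'(2)])
      (rule hom_equivalent_imp_pp_constructs[OF A'(1) hom_equivalent_sym[OF A'(2)]])
  have BB': "B \<le>\<^sub>p\<^sub>p B'" "B' \<le>\<^sub>p\<^sub>p B"
    by (rule hom_equivalent_imp_pp_constructs[OF B B'(2)])
      (rule hom_equivalent_imp_pp_constructs[OF B'(1) hom_equivalent_sym[OF B'(2)]])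
  have "A' \<le>\<^sub>p\<^sub>p B" by (rule pp_constructs_trans[OF A'(1) A B AA'(2) le])
  then have "A' \<le>\<^sub>p\<^sub>p B'" by (rule pp_constructs_trans[OF A'(1) B B'(1) _ BB'(1)])
  moreover have "A' \<in> pp_class A" "B' \<in> pp_class B" using AA' BB' A' B' by (simp_all add: pp_class_def)
  ultimately show "pp_class A \<sqsubseteq>\<^bsub>P_Digraphs\<^esub> pp_class B" by (auto simp: P_Digraphs_def)
qed

lemma less_pp_class_iff:
  assumes "finite_digraph A" "finite_digraph B"
  shows "pp_class A \<sqsubset>\<^bsub>P_Digraphs\<^esub> pp_class B \<longleftrightarrow> A \<le>\<^sub>p\<^sub>p B \<and> \<not> B \<le>\<^sub>p\<^sub>p A"
proof -
  have "pp_class A .=\<^bsub>P_Digraphs\<^esub> pp_class B \<longleftrightarrow> pp_class A = pp_class B"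
    by (simp add: P_Digraphs_def)
  then show ?thesis
    unfolding lless_def le_pp_class_iff[OF assms] using pp_class_eq_iff[OF assms] by blast
qed

lemma carrier_P_Digraphs_E:
  assumes "X \<in> carrier P_Digraphs"
  obtains Z :: "nat pair_pre_digraph" where "finite_digraph Z" "X = pp_class Z"
  using assms by (auto simp: P_Digraphs_def)

lemma lower_cover_eqI:
  assumes fin: "finite_digraph Z" "finite_digraph D" "finite_digraph C"
    and cover: "lower_cover P_Digraphs (pp_class Z) (pp_class C)"
    and le: "Z \<le>\<^sub>p\<^sub>p D" "D \<le>\<^sub>p\<^sub>p C" "\<not> C \<le>\<^sub>p\<^sub>p D"
  shows "pp_class Z = pp_class D"
proof -
  have "\<not> (pp_class Z \<sqsubset>\<^bsub>P_Digraphs\<^esub> pp_class D \<and> pp_class D \<sqsubset>\<^bsub>P_Digraphs\<^esub> pp_class C)"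
    using cover pp_class_carrier[OF fin(2)] unfolding lower_cover_def by blast
  then show ?thesis
    unfolding less_pp_class_iff[OF fin(1,2)] less_pp_class_iff[OF fin(2,3)] pp_class_eq_iff[OF fin(1,2)]
    using le by blast
qed

lemma lower_coverI:
  assumes fin: "finite_digraph D" "finite_digraph C" and D: "D \<le>\<^sub>p\<^sub>p C" "\<not> C \<le>\<^sub>p\<^sub>p D"
    and max: "\<And>Z :: nat pair_pre_digraph. finite_digraph Z \<Longrightarrow> Z \<le>\<^sub>p\<^sub>p C \<Longrightarrow> \<not> C \<le>\<^sub>p\<^sub>p Z \<Longrightarrow> D \<le>\<^sub>p\<^sub>p Z \<Longrightarrow> Z \<le>\<^sub>p\<^sub>p D"
  shows "lower_cover P_Digraphs (pp_class D) (pp_class C)"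
  unfolding lower_cover_def
proof (intro conjI notI)
  show "pp_class D \<in> carrier P_Digraphs" "pp_class C \<in> carrier P_Digraphs"
    using pp_class_carrier fin by blast+
  show "pp_class D \<sqsubset>\<^bsub>P_Digraphs\<^esub> pp_class C" using D less_pp_class_iff[OF fin] by blast
  assume "\<exists>X\<in>carrier P_Digraphs. pp_class D \<sqsubset>\<^bsub>P_Digraphs\<^esub> X \<and> X \<sqsubset>\<^bsub>P_Digraphs\<^esub> pp_class C"
  then obtain X where "X \<in> carrier P_Digraphs" and X: "pp_class D \<sqsubset>\<^bsub>P_Digraphs\<^esub> X" "X \<sqsubset>\<^bsub>P_Digraphs\<^esub> pp_class C"
    by blast
  from this(1) obtain Z :: "nat pair_pre_digraph" where Z: "finite_digraph Z" "X = pp_class Z"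
    by (rule carrier_P_Digraphs_E)
  show False
    using X max[OF Z(1)] unfolding Z(2) less_pp_class_iff[OF fin(1) Z(1)] less_pp_class_iff[OF Z(1) fin(2)]
    by blast
qed

theorem theorem5p24:
  fixes p :: nat
  assumes "prime p"
  shows "{X. lower_cover P_Digraphs X (pp_class (directed_cycle p))} =
           insert (pp_class (T3 \<times>\<^sub>d directed_cycle p))
             {pp_class (directed_cycle (p * q)) | q. prime q \<and> q \<noteq> p}
         \<and> inj_on (\<lambda>q. pp_class (directed_cycle (p * q))) {q. prime q \<and> q \<noteq> p}
         \<and> (\<forall>q. prime q \<and> q \<noteq> p \<longrightarrow>
              pp_class (T3 \<times>\<^sub>d directed_cycle p) \<noteq> pp_class (directed_cycle (p * q)))"
proof -
  let ?C = "directed_cycle p" and ?T = "T3 \<times>\<^sub>d directed_cycle p" and ?D = "\<lambda>q. directed_cycle (p * q)"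
  have p1: "p > 1" "p \<ge> 1" using prime_gt_1_nat[OF assms] by simp_all
  have pq1: "p * q \<ge> 1" if "prime q" for q using p1 prime_gt_1_nat[OF that] by simp
  have C: "finite_digraph ?C" by (rule finite_directed_cycle[OF p1(2)])
  have T: "finite_digraph ?T" by (rule finite_direct_product[OF finite_T3 C])
  have D: "finite_digraph (?D q)" if "prime q" for q by (rule finite_directed_cycle[OF pq1[OF that]])
  have cyc_C: "\<exists>f. cyclic_pol ?C q f" if "prime q" "q \<noteq> p" for q
    using that assms p1 by (intro cyclic_pol_directed_cycle) (simp_all add: primes_coprime)
  have cyc_T: "\<exists>f. cyclic_pol ?T q f" if q: "prime q" "q \<noteq> p" for q
  proof -
    obtain f where "cyclic_pol ?C q f" using cyc_C[OF q] by blast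
    from cyclic_pol_product[OF cyclic_pol_T3 this] show ?thesis using prime_gt_1_nat[OF q(1)] by auto
  qed
  have no_cyc_D: "\<not> cyclic_pol (?D q) r f" if "prime q" "r = q \<or> r = p" for q r f
    using that pq1[OF that(1)] p1 prime_gt_1_nat[OF that(1)] by (intro no_cyclic_pol_directed_cycle) auto
  have pos: "q \<ge> 1" if "prime q" for q :: nat using prime_gt_1_nat[OF that] by simp
  \<comment> \<open>For a cycle of prime length only the arity \<open>p\<close> has to be
    excluded.\<close>
  have below: "X \<le>\<^sub>p\<^sub>p ?C" if X: "finite_digraph X" "\<And>f. \<not> cyclic_pol X p f" for X :: "'x pair_pre_digraph"
  proof (rule pp_constructs_directed_cycle[OF X(1) p1(2)])
    fix r f assume "prime r" "r dvd p"
    then have "r = p" using assms by (simp add: primes_dvd_imp_eq)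
    then show "\<not> cyclic_pol X r f" using X(2) by simp
  qed
  have T_C: "?T \<le>\<^sub>p\<^sub>p ?C" by (rule below[OF T no_cyclic_pol_T3_cycle[OF p1(1)]])
  have D_C: "?D q \<le>\<^sub>p\<^sub>p ?C" if "prime q" for q by (rule below[OF D[OF that]]) (use no_cyc_D[OF that] in blast)
  \<comment> \<open>Cycles are separated from the product by quasi Maltsev polymorphisms, which only
    cycles have.\<close>
  have C_T: "\<not> ?C \<le>\<^sub>p\<^sub>p ?T"
    using quasi_maltsev_mono[OF C T] quasi_maltsev_directed_cycle[OF p1(2)] no_quasi_maltsev_T3_cycle[OF p1(2)]
    by blast
  have D_T: "\<not> ?D q \<le>\<^sub>p\<^sub>p ?T" if "prime q" for q
    using quasi_maltsev_mono[OF D[OF that] T] quasi_maltsev_directed_cycle[OF pq1[OF that]]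
      no_quasi_maltsev_T3_cycle[OF p1(2)] by blast
  \<comment> \<open>Arity \<open>q\<close> separates: \<open>?C\<close> and \<open>?T\<close> have a
    \<open>q\<close>-ary cyclic polymorphism, \<open>?D q\<close> has none.\<close>
  have C_D: "\<not> ?C \<le>\<^sub>p\<^sub>p ?D q" if q: "prime q" "q \<noteq> p" for q
  proof
    assume "?C \<le>\<^sub>p\<^sub>p ?D q"
    moreover obtain f where "cyclic_pol ?C q f" using cyc_C[OF q] by blast
    ultimately obtain g where "cyclic_pol (?D q) q g"
      using cyclic_pol_mono[OF C D[OF q(1)] _ _ pos[OF q(1)]] by blast
    then show False using no_cyc_D[OF q(1)] by blast
  qed
  have T_D: "\<not> ?T \<le>\<^sub>p\<^sub>p ?D q" if q: "prime q" "q \<noteq> p" for q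
  proof
    assume "?T \<le>\<^sub>p\<^sub>p ?D q"
    moreover obtain f where "cyclic_pol ?T q f" using cyc_T[OF q] by blast
    ultimately obtain g where "cyclic_pol (?D q) q g"
      using cyclic_pol_mono[OF T D[OF q(1)] _ _ pos[OF q(1)]] by blast
    then show False using no_cyc_D[OF q(1)] by blast
  qed
  have D_D: "q = r" if q: "prime q" "q \<noteq> p" and r: "prime r" "r \<noteq> p" and le: "?D q \<le>\<^sub>p\<^sub>p ?D r" for q r
  proof (rule ccontr)
    assume "q \<noteq> r"
    then have "coprime r (p * q)" using q r assms by (simp add: primes_coprime)
    then obtain f where "cyclic_pol (?D q) r f" using cyclic_pol_directed_cycle[OF pq1[OF q(1)]] by blast
    then obtain g where "cyclic_pol (?D r) r g"
      using cyclic_pol_mono[OF D[OF q(1)] D[OF r(1)] le _ pos[OF r(1)]] by blast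
    then show False using no_cyc_D[OF r(1)] by blast
  qed
  \<comment> \<open>Whatever lies strictly below the cycle lies below a candidate, so a cover equals
    one. Conversely, a digraph above a candidate and strictly below the cycle lies below some
    candidate, which is the same one because candidates are pairwise incomparable.\<close>
  have "lower_cover P_Digraphs X (pp_class ?C) \<longleftrightarrow>
      X = pp_class ?T \<or> (\<exists>q. X = pp_class (?D q) \<and> prime q \<and> q \<noteq> p)" for X
  proof
    assume cover: "lower_cover P_Digraphs X (pp_class ?C)"
    then have "X \<in> carrier P_Digraphs" by (simp add: lower_cover_def)
    then obtain Z :: "nat pair_pre_digraph" where Z: "finite_digraph Z" "X = pp_class Z"
      by (rule carrier_P_Digraphs_E)
    note cover = cover[unfolded Z(2)]
    have "Z \<le>\<^sub>p\<^sub>p ?C" "\<not> ?C \<le>\<^sub>p\<^sub>p Z"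
      using cover less_pp_class_iff[OF Z(1) C] unfolding lower_cover_def by blast+
    then consider "Z \<le>\<^sub>p\<^sub>p ?T" | q where "prime q" "q \<noteq> p" "Z \<le>\<^sub>p\<^sub>p ?D q"
      using below_directed_cycle_prime[OF assms Z(1)] by blast
    then show "X = pp_class ?T \<or> (\<exists>q. X = pp_class (?D q) \<and> prime q \<and> q \<noteq> p)"
    proof cases
      case 1
      then show ?thesis using lower_cover_eqI[OF Z(1) T C cover _ T_C C_T] Z(2) by blast
    next
      case (2 q)
      then show ?thesis
        using lower_cover_eqI[OF Z(1) D[OF 2(1)] C cover 2(3) D_C[OF 2(1)] C_D[OF 2(1,2)]] Z(2) by blast
    qed
  next
    have "lower_cover P_Digraphs (pp_class ?T) (pp_class ?C)"
    proof (rule lower_coverI[OF T C T_C C_T])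
      fix Z :: "nat pair_pre_digraph"
      assume Z: "finite_digraph Z" and le: "Z \<le>\<^sub>p\<^sub>p ?C" "\<not> ?C \<le>\<^sub>p\<^sub>p Z" "?T \<le>\<^sub>p\<^sub>p Z"
      show "Z \<le>\<^sub>p\<^sub>p ?T"
        using below_directed_cycle_prime[OF assms Z le(1,2)] pp_constructs_trans[OF T Z D le(3)] T_D by blast
    qed
    moreover have "lower_cover P_Digraphs (pp_class (?D q)) (pp_class ?C)" if q: "prime q" "q \<noteq> p" for q
    proof (rule lower_coverI[OF D[OF q(1)] C D_C[OF q(1)] C_D[OF q]])
      fix Z :: "nat pair_pre_digraph"
      assume Z: "finite_digraph Z" and le: "Z \<le>\<^sub>p\<^sub>p ?C" "\<not> ?C \<le>\<^sub>p\<^sub>p Z" "?D q \<le>\<^sub>p\<^sub>p Z"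
      have "\<not> Z \<le>\<^sub>p\<^sub>p ?T" using pp_constructs_trans[OF D[OF q(1)] Z T le(3)] D_T[OF q(1)] by blast
      then obtain r where r: "prime r" "r \<noteq> p" "Z \<le>\<^sub>p\<^sub>p ?D r"
        using below_directed_cycle_prime[OF assms Z le(1,2)] by blast
      have "?D q \<le>\<^sub>p\<^sub>p ?D r" by (rule pp_constructs_trans[OF D[OF q(1)] Z D[OF r(1)] le(3) r(3)])
      then show "Z \<le>\<^sub>p\<^sub>p ?D q" using D_D[OF q r(1,2)] r(3) by simp
    qed
    moreover assume "X = pp_class ?T \<or> (\<exists>q. X = pp_class (?D q) \<and> prime q \<and> q \<noteq> p)"
    ultimately show "lower_cover P_Digraphs X (pp_class ?C)" by blast
  qed
  moreover have "inj_on (\<lambda>q. pp_class (?D q)) {q. prime q \<and> q \<noteq> p}"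
  proof (rule inj_onI)
    fix q r assume "q \<in> {q. prime q \<and> q \<noteq> p}" "r \<in> {q. prime q \<and> q \<noteq> p}"
      and eq: "pp_class (?D q) = pp_class (?D r)"
    then have q: "prime q" "q \<noteq> p" and r: "prime r" "r \<noteq> p" by simp_all
    show "q = r" using eq D_D[OF q r] unfolding pp_class_eq_iff[OF D[OF q(1)] D[OF r(1)]] by blast
  qed
  moreover have "pp_class ?T \<noteq> pp_class (?D q)" if "prime q" "q \<noteq> p" for q
    unfolding pp_class_eq_iff[OF T D[OF that(1)]] using T_D[OF that] by blast
  ultimately show ?thesis by blast
qed

end
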